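(* Let $c_1,c_2,c_3>0$, let $\lambda\in\left(-\infty,-\sum_{j=1}^3c_j\right)$, and let $\Pi_{\lambda,\delta'}=(\varphi_1,\varphi_2,\varphi_3,0,0,0)$ be the smooth family of stationary kink profiles defined in the context. Then $\Pi_{\lambda,\delta'}$ is linearly unstable and nonlinearly unstable for the sine-Gordon model $\mathbf w_t=JE\mathbf w+F(\mathbf w)$ on the tricrystal junction $\mathcal Y$ (with the $\delta'$-interaction of parameter $\lambda$ at the vertex) in each of the following cases: 1) $\lambda\in\left(-\frac{\pi}{2}\sum_{j=1}^3c_j,\,-\sum_{j=1}^3c_j\right)$ and $c_i>0$ for $i=1,2,3$; 2) $\lambda\in\left(-\infty,\,-\frac{\pi}{2}\sum_{j=1}^3c_j\right]$ and $c_1=c_2=c_3$.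
   Context: **Graph and spaces.** $\mathcal Y$ is the tricrystal junction: three edges $E_j=(0,\infty)$, $j=1,2,3$, attached at a common vertex $\nu=0$. $L^2(\mathcal Y)=\bigoplus_{j=1}^3L^2(0,\infty)$ and $H^m(\mathcal Y)=\bigoplus_{j=1}^3H^m(0,\infty)$ with the natural norms (no vertex condition is imposed in $H^m(\mathcal Y)$). **$\delta'$-interaction domain.** For $\lambda\in\mathbb R$ and $c_j>0$, $$D_\lambda=\Big\{(v_j)_{j=1}^3\in H^2(\mathcal Y):\ c_1v_1'(0+)=c_2v_2'(0+)=c_3v_3'(0+),\ \sum_{j=1}^3c_jv_j(0+)=\lambda c_1v_1'(0+)\Big\}.$$ **Model.** For $\mathbf w=(u,v)^\top$, $u=(u_1,u_2,u_3)^\top$, $v=(v_1,v_2,v_3)^\top$ with $u_j,v_j:E_j\to\mathbb R$, the sine-Gordon model is $\mathbf w_t=JE\mathbf w+F(\mathbf w)$, where $$J=\begin{pmatrix}0&I_3\\-I_3&0\end{pmatrix},\qquad E=\begin{pmatrix}\mathcal T_\lambda&0\\0&I_3\end{pmatrix},\qquad F(\mathbf w)=(0,0,0,-\sin u_1,-\sin u_2,-\sin u_3)^\top,$$ and $\mathcal T_\lambda=\big((-c_j^2\frac{d^2}{dx^2})\delta_{j,k}\big)_{1\le j,k\le3}$ with $D(\mathcal T_\lambda)=D_\lambda$. The operator $JE$ acts in $H^1(\mathcal Y)\times L^2(\mathcal Y)$ with domain $D_\lambda\times H^1(\mathcal Y)$. Equivalently, $\partial_tu_j=v_j$ and $\partial_tv_j=c_j^2\partial_x^2u_j-\sin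 u_j$ on $E_j$, with the vertex conditions of $D_\lambda$ imposed on $u$. **Kink profiles.** For $\lambda\in(-\infty,-\sum_jc_j)$ let $y=y(\lambda)>0$ be the unique positive solution of $$\frac{1+y^2}{y}\arctan(y)\,\sum_{j=1}^3c_j=-\lambda,$$ set $b_j=b_j(\lambda)=c_j\ln y(\lambda)$ (so that $b_1/c_1=b_2/c_2=b_3/c_3$), and define $$\varphi_j(x)=4\arctan\big(e^{-(x-b_j)/c_j}\big),\qquad x>0,\ j=1,2,3.$$ Then $(\varphi_j)_{j=1}^3\in D_\lambda$, $-c_j^2\varphi_j''+\sin\varphi_j=0$, and $\Pi_{\lambda,\delta'}=(\varphi_1,\varphi_2,\varphi_3,0,0,0)$ is a stationary solution. **Linearization and linear instability.** Let $\mathcal W_\lambda=\big((-c_j^2\frac{d^2}{dx^2}+\cos(\varphi_j))\delta_{j,k}\big)_{1\le j,k\le 3}$ with $D(\mathcal W_\lambda)=D_\lambda$, and $\mathcal E=\begin{pmatrix}\mathcal W_\lambda&0\\0&I_3\end{pmatrix}$. The linearized equation around $\Pi_{\lambda,\delta'}$ is $\mathbf v_t=J\mathcal E\mathbf v$ in $H^1(\mathcal Y)\times L^2(\mathcal Y)$, with $D(J\mathcal E)=D_\lambda\times H^1(\mathcal Y)$. Linear instability means that there is a growing mode $\mathbf v=e^{\mu t}\Psi$ with $0\ne\Psi\in D(J\mathcal E)$, $J\mathcal E\Psi=\mu\Psi$ and $\mathrm{Re}\,\mu>0$. **Nonlinear instability.** A stationary solution $\Upsilon$ is nonlinearly unstable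 in $X=H^1(\mathcal Y)\times L^2(\mathcal Y)$ if there is $\epsilon>0$ such that for every $\delta>0$ there exist initial data $\mathbf w_0$ with $\|\Upsilon-\mathbf w_0\|_X<\delta$ and a time $t_0=t_0(\mathbf w_0)$ such that $\|\mathbf w(t_0)-\Upsilon\|_X>\epsilon$, where $\mathbf w$ is the solution of the sine-Gordon model with $\mathbf w(0)=\mathbf w_0$. *)

theory Defs
  imports "HOL-Analysis.Analysis" "HOL-Library.Function_Algebras"
begin

text \<open>Functions on an edge are total functions on the reals of which only the values on
  \<open>(0, \<infinity>)\<close> matter.  Elements of \<open>L\<^sup>2\<close> are representatives; equality in \<open>L\<^sup>2\<close> is equality almost
  everywhere on \<open>(0, \<infinity>)\<close> (\<open>state_eq\<close> below).\<close>

definition L2 :: "(real \<Rightarrow> 'a::{banach,second_countable_topology}) set" where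
  "L2 = {f. set_borel_measurable lebesgue {0<..} f \<and>
            set_integrable lebesgue {0<..} (\<lambda>x. (norm (f x))\<^sup>2)}"

definition L2_nrm :: "(real \<Rightarrow> 'a::{banach,second_countable_topology}) \<Rightarrow> real" where
  "L2_nrm f = sqrt (LINT x:{0<..}|lebesgue. (norm (f x))\<^sup>2)"

abbreviation dx :: "(real \<Rightarrow> 'a::real_normed_vector) \<Rightarrow> real \<Rightarrow> 'a" where
  "dx f \<equiv> \<lambda>x. vector_derivative f (at x)"

text \<open>An element of \<open>H\<^sup>1(0, \<infinity>)\<close> is given by its locally absolutely continuous representative: the
  integral identity says that \<open>f\<close> is locally absolutely continuous on \<open>(0, \<infinity>)\<close> and that its
  pointwise a.e. derivative is its weak derivative.  On the null set where \<open>f\<close> is not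
  differentiable, \<open>dx f\<close> has an arbitrary value.\<close>

definition H1 :: "(real \<Rightarrow> 'a::{banach,second_countable_topology}) set" where
  "H1 = {f. f \<in> L2 \<and> dx f \<in> L2 \<and>
            (\<forall>a b. 0 < a \<and> a \<le> b \<longrightarrow> (LINT x:{a..b}|lebesgue. dx f x) = f b - f a)}"

definition H2 :: "(real \<Rightarrow> 'a::{banach,second_countable_topology}) set" where
  "H2 = {f. f \<in> H1 \<and> dx f \<in> H1}"

text \<open>The boundary value \<open>f(0+)\<close>; the limit exists for every \<open>f \<in> H1\<close>.\<close>

definition trace0 :: "(real \<Rightarrow> 'a::t2_space) \<Rightarrow> 'a" where
  "trace0 f = Lim (at_right 0) f"

text \<open>The edges are indexed by the three-element type \<^typ>\<open>3\<close>, whose elements are \<open>1\<close>, \<open>2\<close>, \<open>3\<close>.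
  The scalar type is real for the nonlinear flow and complex for the spectral problem.\<close>

type_synonym 'a jfun = "3 \<Rightarrow> real \<Rightarrow> 'a"
type_synonym 'a state = "'a jfun \<times> 'a jfun"

definition L2Y :: "'a::{banach,second_countable_topology} jfun set" where
  "L2Y = {u. \<forall>j. u j \<in> L2}"

definition H1Y :: "'a::{banach,second_countable_topology} jfun set" where
  "H1Y = {u. \<forall>j. u j \<in> H1}"

definition H2Y :: "'a::{banach,second_countable_topology} jfun set" where
  "H2Y = {u. \<forall>j. u j \<in> H2}"

definition X :: "'a::{banach,second_countable_topology} state set" where
  "X = H1Y \<times> L2Y"

definition X_nrm :: "'a::{banach,second_countable_topology} state \<Rightarrow> real" where
  "X_nrm = (\<lambda>(u, v). sqrt (\<Sum>j\<in>UNIV. (L2_nrm (u j))\<^sup>2 + (L2_nrm (dx (u j)))\<^sup>2 + (L2_nrm (v j))\<^sup>2))"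

definition state_eq :: "'a state \<Rightarrow> 'a state \<Rightarrow> bool" where
  "state_eq w z \<longleftrightarrow> (\<forall>j. AE x in lebesgue. 0 < x \<longrightarrow> fst w j x = fst z j x \<and> snd w j x = snd z j x)"

definition state_scaleR :: "real \<Rightarrow> 'a::real_vector state \<Rightarrow> 'a state" where
  "state_scaleR r w = ((\<lambda>j x. r *\<^sub>R fst w j x), (\<lambda>j x. r *\<^sub>R snd w j x))"

definition state_scaleC :: "complex \<Rightarrow> complex state \<Rightarrow> complex state" where
  "state_scaleC m w = ((\<lambda>j x. m * fst w j x), (\<lambda>j x. m * snd w j x))"

definition Dlam :: "(3 \<Rightarrow> real) \<Rightarrow> real \<Rightarrow> 'a::{banach,second_countable_topology} jfun set" where
  "Dlam c lam = {v \<in> H2Y.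
     c 1 *\<^sub>R trace0 (dx (v 1)) = c 2 *\<^sub>R trace0 (dx (v 2)) \<and>
     c 2 *\<^sub>R trace0 (dx (v 2)) = c 3 *\<^sub>R trace0 (dx (v 3)) \<and>
     (\<Sum>j\<in>UNIV. c j *\<^sub>R trace0 (v j)) = (lam * c 1) *\<^sub>R trace0 (dx (v 1))}"

definition Dom :: "(3 \<Rightarrow> real) \<Rightarrow> real \<Rightarrow> 'a::{banach,second_countable_topology} state set" where
  "Dom c lam = Dlam c lam \<times> H1Y"

definition J_op :: "'a::ab_group_add state \<Rightarrow> 'a state" where
  "J_op = (\<lambda>(p, q). (q, - p))"

definition E_op :: "('a jfun \<Rightarrow> 'a jfun) \<Rightarrow> 'a state \<Rightarrow> 'a state" where
  "E_op A = (\<lambda>(u, v). (A u, v))"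

definition T_op :: "(3 \<Rightarrow> real) \<Rightarrow> 'a::real_normed_vector jfun \<Rightarrow> 'a jfun" where
  "T_op c u = (\<lambda>j x. - ((c j)\<^sup>2 *\<^sub>R dx (dx (u j)) x))"

definition W_op :: "(3 \<Rightarrow> real) \<Rightarrow> real jfun \<Rightarrow> 'a::real_normed_vector jfun \<Rightarrow> 'a jfun" where
  "W_op c phi u = (\<lambda>j x. - ((c j)\<^sup>2 *\<^sub>R dx (dx (u j)) x) + cos (phi j x) *\<^sub>R u j x)"

definition F_nl :: "real state \<Rightarrow> real state" where
  "F_nl = (\<lambda>(u, v). ((\<lambda>j x. 0), (\<lambda>j x. - sin (u j x))))"

definition X_continuous :: "real \<Rightarrow> (real \<Rightarrow> real state) \<Rightarrow> bool" where
  "X_continuous T w \<longleftrightarrow> (\<forall>t\<in>{0..T}. w t \<in> X \<and> ((\<lambda>s. X_nrm (w s - w t)) \<longlongrightarrow> 0) (at t within {0..T}))"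

text \<open>For a continuous curve \<open>w\<close> in \<open>X\<close> the \<open>X\<close>-valued integral \<open>W t = \<integral>\<^sub>0\<^sup>t w s ds\<close> is the (unique)
  curve with \<open>W 0 = 0\<close> that is differentiable in the norm of \<open>X\<close> with derivative \<open>w\<close>.\<close>

definition X_integral_curve :: "real \<Rightarrow> (real \<Rightarrow> real state) \<Rightarrow> (real \<Rightarrow> real state) \<Rightarrow> bool" where
  "X_integral_curve T w W \<longleftrightarrow> state_eq (W 0) 0 \<and>
     (\<forall>t\<in>{0..T}. W t \<in> X \<and>
        ((\<lambda>s. X_nrm (state_scaleR (1 / (s - t)) (W s - W t) - w t)) \<longlongrightarrow> 0) (at t within {0..T}))"

text \<open>Mild solutions in \<open>X\<close> of \<open>w\<^sub>t = JE w + F(w)\<close>, \<open>w(0) = w0\<close> on \<open>[0, T]\<close>: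
  \<open>w\<close> is continuous in \<open>X\<close>, \<open>\<integral>\<^sub>0\<^sup>t w ds\<close> lies in the domain of \<open>JE\<close>, and
  \<open>w t = w0 + JE (\<integral>\<^sub>0\<^sup>t w ds) + \<integral>\<^sub>0\<^sup>t F(w) ds\<close>.  This notion makes sense for every \<open>w0\<close> in \<open>X\<close>.\<close>

definition sG_solution ::
  "(3 \<Rightarrow> real) \<Rightarrow> real \<Rightarrow> real state \<Rightarrow> real \<Rightarrow> (real \<Rightarrow> real state) \<Rightarrow> bool" where
  "sG_solution c lam w0 T w \<longleftrightarrow> X_continuous T w \<and>
     (\<exists>W Z. X_integral_curve T w W \<and> X_integral_curve T (\<lambda>t. F_nl (w t)) Z \<and>
        (\<forall>t\<in>{0..T}. W t \<in> Dom c lam \<and>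
           state_eq (w t) (w0 + J_op (E_op (T_op c) (W t)) + Z t)))"

definition y_kink :: "(3 \<Rightarrow> real) \<Rightarrow> real \<Rightarrow> real" where
  "y_kink c lam = (THE y. 0 < y \<and> (1 + y\<^sup>2) / y * arctan y * (\<Sum>j\<in>UNIV. c j) = - lam)"

definition b_kink :: "(3 \<Rightarrow> real) \<Rightarrow> real \<Rightarrow> 3 \<Rightarrow> real" where
  "b_kink c lam j = c j * ln (y_kink c lam)"

definition phi_kink :: "(3 \<Rightarrow> real) \<Rightarrow> real \<Rightarrow> real jfun" where
  "phi_kink c lam = (\<lambda>j x. 4 * arctan (exp (- (x - b_kink c lam j) / c j)))"

definition Pi_kink :: "(3 \<Rightarrow> real) \<Rightarrow> real \<Rightarrow> real state" where
  "Pi_kink c lam = (phi_kink c lam, 0)"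

definition linearly_unstable :: "(3 \<Rightarrow> real) \<Rightarrow> real \<Rightarrow> real state \<Rightarrow> bool" where
  "linearly_unstable c lam P \<longleftrightarrow>
     (\<exists>(mu::complex) (Psi::complex state).
        Psi \<in> Dom c lam \<and> \<not> state_eq Psi 0 \<and>
        state_eq (J_op (E_op (W_op c (fst P)) Psi)) (state_scaleC mu Psi) \<and>
        0 < Re mu)"

definition nonlinearly_unstable :: "(3 \<Rightarrow> real) \<Rightarrow> real \<Rightarrow> real state \<Rightarrow> bool" where
  "nonlinearly_unstable c lam P \<longleftrightarrow>
     (\<exists>eps>0. \<forall>delta>0. \<exists>w0 \<in> X. X_nrm (P - w0) < delta \<and>
        (\<exists>t0\<ge>0. \<exists>w. sG_solution c lam w0 t0 w \<and> X_nrm (w t0 - P) > eps))"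

end

theory Submission
  imports Defs
begin

text \<open>In the variable \<open>s = x / c\<^sub>j\<close> all three edges carry the same profile \<open>\<psi>(s) = 4 arctan (exp (s0 - s))\<close> with
  \<open>s0 = ln y\<close>, and the subspace \<open>u\<^sub>j(x) = U(x / c\<^sub>j)\<close> is invariant under the nonlinear flow.  On it the model is
  the sine-Gordon equation on a half-line with the Robin condition \<open>U(0) = \<beta> U'(0)\<close>, where \<open>\<beta>\<close> is \<open>\<lambda>\<close> divided by
  the sum of the \<open>c\<^sub>j\<close>.  The linearized operator \<open>L = - d\<^sup>2/ds\<^sup>2 + cos \<psi>\<close> is of Poeschl-Teller type, with decaying
  solutions \<open>exp (- k s) (k + tanh (s - s0))\<close> of \<open>L g = (1 - k\<^sup>2) g\<close>.  The Robin condition holds for some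
  \<open>k = \<kappa> > 1\<close>, which gives a positive mode \<open>g\<close> growing at the rate \<open>\<mu> = sqrt (\<kappa>\<^sup>2 - 1)\<close>.

  For the nonlinear statement one constructs a solution \<open>U\<close> on the unstable manifold as a power series in
  \<open>exp (\<mu> \<tau>)\<close>, \<open>\<tau> \<le> 0\<close>, with coefficients \<open>u\<^sub>0 = \<psi>\<close>, \<open>u\<^sub>1\<close> a multiple of \<open>g\<close>, and \<open>u\<^sub>n\<close> for \<open>n \<ge> 2\<close> obtained by
  applying the resolvent of \<open>L\<close> at \<open>- n\<^sup>2 \<mu>\<^sup>2\<close> to a polynomial in the lower modes.  Comparison with \<open>g\<close> shows that
  this resolvent is bounded by \<open>1 / ((n\<^sup>2 - 1) \<mu>\<^sup>2)\<close> in the sup norm weighted by \<open>g\<close>, so the series converges.  It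
  tends to the kink as \<open>\<tau> \<rightarrow> - \<infinity>\<close>, while at \<open>\<tau> = 0\<close> it is a fixed state different from the kink.\<close>

section \<open>Edge functions and exponentially decaying profiles\<close>

lemma exp_decay_integrable:
  fixes a :: real
  assumes "a > 0"
  shows "set_integrable lebesgue {0<..} (\<lambda>x. exp (- x / a)^2)"
proof -
  have e: "exp (- x / a)^2 = exp (- (2 / a) * x)" for x
    by (simp add: power2_eq_square flip: exp_add)
  have "(\<lambda>x. exp (- x / a)^2) integrable_on {0..}"
    unfolding e using assms by (intro integrable_on_exp_minus_to_infinity) simp
  then have "set_integrable lebesgue {0..} (\<lambda>x. exp (- x / a)^2)"
    by (subst absolutely_integrable_on_iff_nonneg) auto
  then show ?thesis
    by (rule set_integrable_subset) auto
qed

definition L2_exp :: "real \<Rightarrow> real" where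
  "L2_exp a = L2_nrm (\<lambda>x. exp (- x / a))"

lemma L2_nrm_nonneg: "0 \<le> L2_nrm f"
  by (simp add: L2_nrm_def set_lebesgue_integral_def)

lemma L2_nrm_le_exp:
  assumes "a > 0" "K \<ge> 0" and f: "\<And>x. x > 0 \<Longrightarrow> norm (f x) \<le> K * exp (- x / a)"
  shows "L2_nrm f \<le> K * L2_exp a"
proof -
  have "(LINT x:{0<..}|lebesgue. (norm (f x))\<^sup>2) \<le> (LINT x:{0<..}|lebesgue. K^2 * exp (- x / a)^2)"
    unfolding set_lebesgue_integral_def
  \<comment> \<open>If the left integrand is not integrable, its integral is 0 by convention, so the
    bound covers that case as well.\<close>
  proof (rule integral_mono')
    show "integrable lebesgue (\<lambda>x. indicat_real {0<..} x *\<^sub>R (K^2 * exp (- x / a)^2))"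
      using set_integrable_mult_right[OF exp_decay_integrable[OF assms(1)], of "K^2"]
      unfolding set_integrable_def .
    fix x :: real
    show "indicat_real {0<..} x *\<^sub>R (norm (f x))\<^sup>2 \<le> indicat_real {0<..} x *\<^sub>R (K^2 * exp (- x / a)^2)"
      using power_mono[OF f[of x], of 2] by (auto simp: indicator_def power_mult_distrib)
  qed (auto simp: indicator_def)
  also have "\<dots> = K^2 * (LINT x:{0<..}|lebesgue. exp (- x / a)^2)"
    by simp
  finally have "L2_nrm f \<le> sqrt (K^2 * (LINT x:{0<..}|lebesgue. exp (- x / a)^2))"
    unfolding L2_nrm_def by (rule real_sqrt_le_mono)
  then show ?thesis
    using assms(2) by (simp add: L2_exp_def L2_nrm_def real_sqrt_mult)
qed

lemma L2_exp_bound: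
  fixes f :: "real \<Rightarrow> 'a::euclidean_space"
  assumes "a > 0" and cont: "continuous_on {0<..} f"
    and f: "\<And>x. x > 0 \<Longrightarrow> norm (f x) \<le> K * exp (- x / a)"
  shows "f \<in> L2"
proof -
  have m: "f \<in> borel_measurable (lebesgue_on {0<..})"
    by (rule continuous_imp_measurable_on_sets_lebesgue[OF cont]) simp
  have "(\<lambda>x. (norm (f x))^2) \<in> borel_measurable (lebesgue_on {0<..})"
    using m by measurable
  then have m2: "set_borel_measurable lebesgue {0<..} (\<lambda>x. (norm (f x))^2)"
    by (simp add: set_borel_measurable_def borel_measurable_restrict_space_iff)
  have "set_integrable lebesgue {0<..} (\<lambda>x. (norm (f x))\<^sup>2)"
  proof (rule set_integrable_bound[OF set_integrable_mult_right[OF exp_decay_integrable[OF assms(1)], of "K^2"] m2])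
    show "AE x in lebesgue. x \<in> {0<..} \<longrightarrow> norm ((norm (f x))\<^sup>2) \<le> norm (K\<^sup>2 * (exp (- x / a))\<^sup>2)"
      using power_mono[OF f, of _ 2] by (auto simp: power_mult_distrib)
  qed
  then show ?thesis
    using m by (simp add: L2_def set_borel_measurable_def borel_measurable_restrict_space_iff)
qed

lemma L2_cong:
  assumes "\<And>x. x > 0 \<Longrightarrow> f x = g x"
  shows "f \<in> L2 \<longleftrightarrow> g \<in> L2"
proof -
  have "(\<lambda>x. indicat_real {0<..} x *\<^sub>R f x) = (\<lambda>x. indicat_real {0<..} x *\<^sub>R g x)"
    "(\<lambda>x. indicat_real {0<..} x *\<^sub>R (norm (f x))^2) = (\<lambda>x. indicat_real {0<..} x *\<^sub>R (norm (g x))^2)"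
    by (auto simp: fun_eq_iff assms split: split_indicator)
  then show ?thesis
    by (simp add: L2_def set_borel_measurable_def set_integrable_def)
qed

lemma vector_derivative_cong_pos:
  fixes f g :: "real \<Rightarrow> 'a::real_normed_vector"
  assumes "\<And>x. x > 0 \<Longrightarrow> f x = g x" "x > 0"
  shows "dx f x = dx g x"
proof (rule vector_derivative_cong_eq)
  show "\<forall>\<^sub>F y in nhds x. y \<in> UNIV \<longrightarrow> f y = g y"
    using eventually_nhds_in_open[of "{0<..}" x] assms by (auto elim!: eventually_mono)
qed (use assms in auto)

lemma H1_cong:
  fixes f g :: "real \<Rightarrow> 'a::{banach,second_countable_topology}"
  assumes "\<And>x. x > 0 \<Longrightarrow> f x = g x"
  shows "f \<in> H1 \<longleftrightarrow> g \<in> H1"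
proof -
  have d: "dx f x = dx g x" if "x > 0" for x
    using vector_derivative_cong_pos assms that by blast
  have "(LINT x:{a..b}|lebesgue. dx f x) = (LINT x:{a..b}|lebesgue. dx g x)" if "0 < a" for a b
    unfolding set_lebesgue_integral_def
    by (rule Bochner_Integration.integral_cong) (use d that in \<open>auto simp: indicator_def\<close>)
  then show ?thesis
    using L2_cong[OF assms] L2_cong[OF d] assms by (auto simp: H1_def)
qed

text \<open>At positive points \<open>dx f\<close> is the classical derivative, so the integral
  identity in \<open>H1\<close> is the fundamental theorem of calculus, and the exponential bounds
  give both \<open>L2\<close> conditions.\<close>

lemma H1_exp_bound:
  fixes f f' :: "real \<Rightarrow> 'a::euclidean_space"
  assumes "a > 0" and d: "\<And>x. x > 0 \<Longrightarrow> (f has_vector_derivative f' x) (at x)"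
    and c: "continuous_on {0<..} f'"
    and b: "\<And>x. x > 0 \<Longrightarrow> norm (f x) \<le> K * exp (- x / a)"
    and b': "\<And>x. x > 0 \<Longrightarrow> norm (f' x) \<le> K' * exp (- x / a)"
  shows "f \<in> H1"
proof -
  have e: "dx f x = f' x" if "x > 0" for x
    using d[OF that] by (rule vector_derivative_at)
  have "continuous_on {0<..} f"
    by (meson continuous_at_imp_continuous_on d greaterThan_iff has_vector_derivative_continuous)
  then have "f \<in> L2"
    using assms(1) b by (intro L2_exp_bound)
  moreover have "dx f \<in> L2"
    using L2_cong[of "dx f" f'] e L2_exp_bound[OF assms(1) c b'] by blast
  moreover have "(LINT x:{l..r}|lebesgue. dx f x) = f r - f l" if "0 < l" "l \<le> r" for l r
  proof -
    have "(LINT x:{l..r}|lebesgue. dx f x) = (LINT x:{l..r}|lebesgue. f' x)"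
      unfolding set_lebesgue_integral_def
      by (rule Bochner_Integration.integral_cong) (use e that in \<open>auto simp: indicator_def\<close>)
    also have "\<dots> = integral {l..r} f'"
      by (intro set_lebesgue_integral_eq_integral absolutely_integrable_continuous_real
          continuous_on_subset[OF c]) (use that in auto)
    also have "\<dots> = f r - f l"
      using that by (intro integral_unique fundamental_theorem_of_calculus
          has_vector_derivative_at_within[OF d]) auto
    finally show ?thesis .
  qed
  ultimately show ?thesis by (auto simp: H1_def)
qed

section \<open>Profiles in the variable s = x / c_j, where c_j d/dx becomes d/ds\<close>

definition lift :: "(3 \<Rightarrow> real) \<Rightarrow> (real \<Rightarrow> 'a) \<Rightarrow> 'a jfun" where
  "lift c k = (\<lambda>j x. k (x / c j))"

lemma lift_derivative:
  fixes k :: "real \<Rightarrow> 'a::real_normed_vector"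
  assumes "0 < c j" "\<And>s. s > 0 \<Longrightarrow> (k has_vector_derivative k1 s) (at s)" "x > 0"
  shows "(lift c k j has_vector_derivative (1 / c j) *\<^sub>R lift c k1 j x) (at x)"
proof -
  have "((\<lambda>x. x / c j) has_vector_derivative 1 / c j) (at x)"
    using assms by (auto intro!: derivative_eq_intros simp: has_vector_derivative_def field_simps)
  then show ?thesis
    using vector_diff_chain_at[of "\<lambda>x. x / c j" "1 / c j" x k "k1 (x / c j)"] assms
    by (simp add: lift_def o_def)
qed

lemma lift_bound:
  fixes k :: "real \<Rightarrow> 'a::real_normed_vector"
  assumes "0 < c j" "\<And>s. s > 0 \<Longrightarrow> norm (k s) \<le> K * exp (- s)" "x > 0"
  shows "norm (lift c k j x) \<le> K * exp (- x / c j)"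
  using assms(2)[of "x / c j"] assms by (simp add: lift_def)

lemma lift_continuous:
  fixes k :: "real \<Rightarrow> 'a::real_normed_vector"
  assumes "0 < c j" "continuous_on {0<..} k"
  shows "continuous_on {0<..} (lift c k j)"
  unfolding lift_def
  by (rule continuous_on_compose2[OF assms(2)]) (use assms(1) in \<open>auto intro!: continuous_intros\<close>)

lemma lift_trace:
  fixes k :: "real \<Rightarrow> 'a::real_normed_vector"
  assumes "0 < c j" "(k \<longlongrightarrow> l) (at_right 0)"
  shows "(lift c k j \<longlongrightarrow> l) (at_right 0)"
proof -
  have "filterlim (\<lambda>x. x / c j) (at_right 0) (at_right 0)"
    unfolding filterlim_at
  proof
    have "((\<lambda>x. x / c j) \<longlongrightarrow> 0 / c j) (at_right 0)"
      using assms(1) by (intro tendsto_intros) auto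
    then show "((\<lambda>x. x / c j) \<longlongrightarrow> 0) (at_right 0)" by simp
    show "\<forall>\<^sub>F x in at_right 0. x / c j \<in> {0<..} \<and> x / c j \<noteq> 0"
      using assms(1) by (auto intro!: eventually_mono[OF eventually_at_right_less[of 0]])
  qed
  then show ?thesis
    unfolding lift_def by (rule filterlim_compose[OF assms(2)])
qed

lemma lift_L2Y:
  fixes k :: "real \<Rightarrow> 'a::euclidean_space"
  assumes "\<forall>j. 0 < c j" "continuous_on {0<..} k" "\<And>s. s > 0 \<Longrightarrow> norm (k s) \<le> K * exp (- s)"
  shows "lift c k \<in> L2Y"
  unfolding L2Y_def mem_Collect_eq
proof
  fix j
  show "lift c k j \<in> L2"
    using assms lift_bound[of c j k K] by (intro L2_exp_bound[of "c j" _ K] lift_continuous) auto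
qed

lemma lift_H1Y:
  fixes k k1 :: "real \<Rightarrow> 'a::euclidean_space"
  assumes c: "\<forall>j. 0 < c j" and d: "\<And>s. s > 0 \<Longrightarrow> (k has_vector_derivative k1 s) (at s)"
    and cont: "continuous_on {0<..} k1"
    and b: "\<And>s. s > 0 \<Longrightarrow> norm (k s) \<le> K * exp (- s)" "\<And>s. s > 0 \<Longrightarrow> norm (k1 s) \<le> K * exp (- s)"
  shows "lift c k \<in> H1Y"
  unfolding H1Y_def mem_Collect_eq
proof
  fix j
  have cj: "0 < c j" using c by auto
  show "lift c k j \<in> H1"
  proof (rule H1_exp_bound[where f' = "\<lambda>x. (1 / c j) *\<^sub>R lift c k1 j x"])
    show "norm ((1 / c j) *\<^sub>R lift c k1 j x) \<le> (K / c j) * exp (- x / c j)" if "x > 0" for x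
      using lift_bound[of c j k1 K, OF cj b(2) that] cj by (simp add: field_simps)
  qed (use lift_derivative[of c j k k1] lift_bound[of c j k K] lift_continuous[of c j k1] cj d b cont
      in \<open>auto intro!: continuous_intros\<close>)
qed

lemma dx_lift:
  fixes k :: "real \<Rightarrow> 'a::real_normed_vector"
  assumes "0 < c j" "\<And>s. s > 0 \<Longrightarrow> (k has_vector_derivative k1 s) (at s)" "x > 0"
  shows "dx (lift c k j) x = (1 / c j) *\<^sub>R lift c k1 j x"
  using assms by (intro vector_derivative_at lift_derivative)

lemma dx_dx_lift:
  fixes k :: "real \<Rightarrow> 'a::real_normed_vector"
  assumes "0 < c j" "\<And>s. s > 0 \<Longrightarrow> (k has_vector_derivative k1 s) (at s)"
    "\<And>s. s > 0 \<Longrightarrow> (k1 has_vector_derivative k2 s) (at s)" "x > 0"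
  shows "dx (dx (lift c k j)) x = (1 / (c j)\<^sup>2) *\<^sub>R lift c k2 j x"
proof -
  have "dx (dx (lift c k j)) x = dx (\<lambda>x. (1 / c j) *\<^sub>R lift c k1 j x) x"
    using assms dx_lift[of c j k k1] by (intro vector_derivative_cong_pos) auto
  also have "\<dots> = (1 / c j) *\<^sub>R ((1 / c j) *\<^sub>R lift c k2 j x)"
    by (rule vector_derivative_at) (intro bounded_linear.has_vector_derivative[OF bounded_linear_scaleR_right] lift_derivative assms)
  finally show ?thesis by (simp add: power2_eq_square)
qed

lemma trace0_eqI:
  assumes "(f \<longlongrightarrow> l) (at_right (0::real))"
  shows "trace0 f = l"
  unfolding trace0_def using assms by (intro tendsto_Lim) auto

text \<open>Since c_j d/dx acts as d/ds, the weighted slopes at the vertex all equal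
  \<open>l1\<close>, and the remaining vertex condition becomes the Robin condition
  \<open>robin\<close> between \<open>l\<close> and \<open>l1\<close>.\<close>

lemma lift_Dlam:
  fixes k k1 k2 :: "real \<Rightarrow> 'a::euclidean_space"
  assumes c: "\<forall>j. 0 < c j" and d: "\<And>s. s > 0 \<Longrightarrow> (k has_vector_derivative k1 s) (at s)"
    and d1: "\<And>s. s > 0 \<Longrightarrow> (k1 has_vector_derivative k2 s) (at s)"
    and cont: "continuous_on {0<..} k2"
    and b: "\<And>s. s > 0 \<Longrightarrow> norm (k s) \<le> K * exp (- s)" "\<And>s. s > 0 \<Longrightarrow> norm (k1 s) \<le> K * exp (- s)"
      "\<And>s. s > 0 \<Longrightarrow> norm (k2 s) \<le> K * exp (- s)"
    and l: "(k \<longlongrightarrow> l) (at_right 0)" "(k1 \<longlongrightarrow> l1) (at_right 0)"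
    and robin: "(\<Sum>j\<in>UNIV. c j) *\<^sub>R l = lam *\<^sub>R l1"
  shows "lift c k \<in> Dlam c lam"
proof -
  have c1: "continuous_on {0<..} k1"
    by (meson continuous_at_imp_continuous_on d1 greaterThan_iff has_vector_derivative_continuous)
  have "dx (lift c k j) \<in> H1" for j
  proof -
    have cj: "0 < c j" using c by auto
    have "(\<lambda>x. (1 / c j) *\<^sub>R lift c k1 j x) \<in> H1"
    proof (rule H1_exp_bound[where f' = "\<lambda>x. (1 / c j) *\<^sub>R ((1 / c j) *\<^sub>R lift c k2 j x)"])
      show "norm ((1 / c j) *\<^sub>R lift c k1 j x) \<le> (K / c j) * exp (- x / c j)" if "x > 0" for x
        using lift_bound[of c j k1 K, OF cj b(2) that] cj by (simp add: field_simps)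
      show "norm ((1 / c j) *\<^sub>R ((1 / c j) *\<^sub>R lift c k2 j x)) \<le> (K / (c j)^2) * exp (- x / c j)" if "x > 0" for x
        using lift_bound[of c j k2 K, OF cj b(3) that] cj by (simp add: field_simps power2_eq_square)
      show "((\<lambda>x. (1 / c j) *\<^sub>R lift c k1 j x) has_vector_derivative (1 / c j) *\<^sub>R ((1 / c j) *\<^sub>R lift c k2 j x)) (at x)"
        if "x > 0" for x
        by (intro bounded_linear.has_vector_derivative[OF bounded_linear_scaleR_right] lift_derivative d1 cj that)
    qed (use cj cont lift_continuous in \<open>auto intro!: continuous_intros\<close>)
    then show ?thesis
      using H1_cong[of "dx (lift c k j)" "\<lambda>x. (1 / c j) *\<^sub>R lift c k1 j x"] dx_lift[of c j k k1] cj d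
      by blast
  qed
  moreover have "lift c k \<in> H1Y"
    using c d c1 b by (intro lift_H1Y) auto
  ultimately have "lift c k \<in> H2Y"
    by (auto simp: H1Y_def H2Y_def H2_def)
  moreover have t: "trace0 (lift c k j) = l" for j
    using c l by (intro trace0_eqI lift_trace) auto
  moreover have t1: "c j *\<^sub>R trace0 (dx (lift c k j)) = l1" for j
  proof -
    have cj: "0 < c j" using c by auto
    have "((\<lambda>x. (1 / c j) *\<^sub>R lift c k1 j x) \<longlongrightarrow> (1 / c j) *\<^sub>R l1) (at_right 0)"
      using cj l by (intro tendsto_intros lift_trace) auto
    moreover have "\<forall>\<^sub>F x in at_right 0. dx (lift c k j) x = (1 / c j) *\<^sub>R lift c k1 j x"
      using dx_lift[of c j k k1] cj d by (auto intro!: eventually_mono[OF eventually_at_right_less[of 0]])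
    ultimately have "(dx (lift c k j) \<longlongrightarrow> (1 / c j) *\<^sub>R l1) (at_right 0)"
      by (simp add: tendsto_cong)
    then show ?thesis
      using cj by (simp add: trace0_eqI)
  qed
  moreover have "(lam * c 1) *\<^sub>R trace0 (dx (lift c k 1)) = lam *\<^sub>R l1"
    using t1[of 1] by (metis scaleR_scaleR)
  ultimately show ?thesis
    using robin by (simp add: Dlam_def flip: scaleR_sum_left)
qed

text \<open>The weight 2 counts the two undifferentiated components;
  \<open>1 / (c j)\<^sup>2\<close> comes from the chain rule in \<open>dx\<close>.\<close>

definition X_exp :: "(3 \<Rightarrow> real) \<Rightarrow> real" where
  "X_exp c = sqrt (\<Sum>j\<in>UNIV. (2 + 1 / (c j)\<^sup>2) * (L2_exp (c j))\<^sup>2)"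

text \<open>Convergence in \<open>X\<close> is proved below through this bound, from pointwise
  estimates on the half-line with the weight \<open>exp (- s)\<close>.\<close>

lemma X_nrm_lift_le:
  fixes k k1 m :: "real \<Rightarrow> 'a::euclidean_space"
  assumes c: "\<forall>j. 0 < c j" and d: "\<And>s. s > 0 \<Longrightarrow> (k has_vector_derivative k1 s) (at s)"
    and K: "0 \<le> K"
    and b: "\<And>s. s > 0 \<Longrightarrow> norm (k s) \<le> K * exp (- s)" "\<And>s. s > 0 \<Longrightarrow> norm (k1 s) \<le> K * exp (- s)"
      "\<And>s. s > 0 \<Longrightarrow> norm (m s) \<le> K * exp (- s)"
  shows "X_nrm (lift c k, lift c m) \<le> K * X_exp c"
proof -
  have "(L2_nrm (lift c k j))\<^sup>2 + (L2_nrm (dx (lift c k j)))\<^sup>2 + (L2_nrm (lift c m j))\<^sup>2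
      \<le> K\<^sup>2 * ((2 + 1 / (c j)\<^sup>2) * (L2_exp (c j))\<^sup>2)" for j
  proof -
    have cj: "0 < c j" using c by auto
    have "L2_nrm (lift c k j) \<le> K * L2_exp (c j)"
      using lift_bound[of c j k K] b cj K by (intro L2_nrm_le_exp) auto
    moreover have "L2_nrm (lift c m j) \<le> K * L2_exp (c j)"
      using lift_bound[of c j m K] b cj K by (intro L2_nrm_le_exp) auto
    moreover have "L2_nrm (dx (lift c k j)) \<le> (K / c j) * L2_exp (c j)"
    proof (rule L2_nrm_le_exp)
      show "norm (dx (lift c k j) x) \<le> (K / c j) * exp (- x / c j)" if "x > 0" for x
        using lift_bound[of c j k1 K, OF cj b(2) that] dx_lift[of c j k k1 x] cj d that by (simp add: field_simps)
    qed (use cj K in auto)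
    ultimately have "(L2_nrm (lift c k j))\<^sup>2 \<le> (K * L2_exp (c j))\<^sup>2"
      "(L2_nrm (lift c m j))\<^sup>2 \<le> (K * L2_exp (c j))\<^sup>2"
      "(L2_nrm (dx (lift c k j)))\<^sup>2 \<le> ((K / c j) * L2_exp (c j))\<^sup>2"
      by (auto intro!: power_mono L2_nrm_nonneg)
    moreover have "K\<^sup>2 * ((2 + 1 / (c j)\<^sup>2) * (L2_exp (c j))\<^sup>2) = (K * L2_exp (c j))\<^sup>2 + (K * L2_exp (c j))\<^sup>2 + ((K / c j) * L2_exp (c j))\<^sup>2"
      using cj by (simp add: field_simps)
    ultimately show ?thesis by linarith
  qed
  then have "(\<Sum>j\<in>UNIV. (L2_nrm (lift c k j))\<^sup>2 + (L2_nrm (dx (lift c k j)))\<^sup>2 + (L2_nrm (lift c m j))\<^sup>2)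
    \<le> K\<^sup>2 * (\<Sum>j\<in>UNIV. (2 + 1 / (c j)\<^sup>2) * (L2_exp (c j))\<^sup>2)"
    unfolding sum_distrib_left by (intro sum_mono)
  then have "X_nrm (lift c k, lift c m) \<le> sqrt (K\<^sup>2 * (\<Sum>j\<in>UNIV. (2 + 1 / (c j)\<^sup>2) * (L2_exp (c j))\<^sup>2))"
    unfolding X_nrm_def prod.case by (rule real_sqrt_le_mono)
  then show ?thesis
    using K by (simp add: X_exp_def real_sqrt_mult)
qed

section \<open>A resolvent estimate by comparison\<close>

lemma has_antiderivative:
  fixes f :: "real \<Rightarrow> real"
  assumes "continuous_on UNIV f"
  obtains F where "\<And>x. (F has_real_derivative f x) (at x)"
proof -
  have "\<exists>F. \<forall>x::real. - \<infinity> < ereal x \<longrightarrow> ereal x < \<infinity> \<longrightarrow> (F has_vector_derivative f x) (at x)"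
    by (rule einterval_antiderivative) (use assms in \<open>auto simp: continuous_on_eq_continuous_at\<close>)
  then show ?thesis
    using that by (auto simp: has_real_derivative_iff_has_vector_derivative)
qed

text \<open>Both \<open>B - A\<close> and \<open>B + A\<close> are nondecreasing on the
  half-line.\<close>

lemma deriv_dominated:
  fixes A B :: "real \<Rightarrow> real"
  assumes A: "\<And>x. (A has_real_derivative a x) (at x)"
    and B: "\<And>x. (B has_real_derivative b x) (at x)"
    and ab: "\<And>x. x \<ge> 0 \<Longrightarrow> \<bar>a x\<bar> \<le> b x" and st: "0 \<le> s" "s \<le> t"
  shows "\<bar>A t - A s\<bar> \<le> B t - B s"
proof -
  have "B s - A s \<le> B t - A t"
  proof (rule DERIV_nonneg_imp_nondecreasing[OF st(2)])
    fix x assume "s \<le> x" "x \<le> t"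
    then show "\<exists>y. ((\<lambda>x. B x - A x) has_real_derivative y) (at x) \<and> 0 \<le> y"
      using ab[of x] st by (intro exI[of _ "b x - a x"]) (auto intro!: derivative_intros A B)
  qed
  moreover have "B s + A s \<le> B t + A t"
  proof (rule DERIV_nonneg_imp_nondecreasing[OF st(2)])
    fix x assume "s \<le> x" "x \<le> t"
    then show "\<exists>y. ((\<lambda>x. B x + A x) has_real_derivative y) (at x) \<and> 0 \<le> y"
      using ab[of x] st by (intro exI[of _ "b x + a x"]) (auto intro!: derivative_intros A B)
  qed
  ultimately show ?thesis by linarith
qed

text \<open>\<open>P\<close> is the tail integral of \<open>F\<close> from s to infinity, written
  \<open>I - A s\<close> with \<open>I\<close> the limit of an antiderivative \<open>A\<close> along
  the integers. The majorant \<open>E\<close> is the tail integral of \<open>e\<close>, so the bound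
  passes to the tails.\<close>

lemma decaying_antiderivative:
  fixes F E e :: "real \<Rightarrow> real"
  assumes F: "continuous_on UNIV F"
    and E: "\<And>s. (E has_real_derivative - e s) (at s)" "(E \<longlongrightarrow> 0) at_top"
    and M: "\<And>s. s \<ge> 0 \<Longrightarrow> \<bar>F s\<bar> \<le> M * e s"
  obtains P where "\<And>s. (P has_real_derivative - F s) (at s)" "\<And>s. s \<ge> 0 \<Longrightarrow> \<bar>P s\<bar> \<le> M * E s"
proof -
  obtain A where A: "\<And>x. (A has_real_derivative F x) (at x)"
    using has_antiderivative[OF F] by blast
  have dom: "\<bar>A t - A s\<bar> \<le> M * E s - M * E t" if "0 \<le> s" "s \<le> t" for s t
  proof -
    have "((\<lambda>s. - (M * E s)) has_real_derivative M * e s) (at s)" for s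
      by (auto intro!: derivative_eq_intros E)
    from deriv_dominated[OF A this M that] show ?thesis by simp
  qed
  have Elim: "(\<lambda>n. E (real n)) \<longlonglongrightarrow> 0"
    by (rule filterlim_compose[OF E(2) filterlim_real_sequentially])
  have "Cauchy (\<lambda>n. M * E (real n))"
    by (intro LIMSEQ_imp_Cauchy[of _ "M * 0"] tendsto_intros Elim)
  \<comment> \<open>The increments of \<open>A\<close> are at most those of a convergent sequence,
    which makes \<open>A\<close> Cauchy along the integers.\<close>
  moreover have "dist (A (real m)) (A (real n)) \<le> dist (M * E (real m)) (M * E (real n))" for m n
    using dom[of m n] dom[of n m] by (cases "m \<le> n") (auto simp: dist_real_def)
  ultimately have "Cauchy (\<lambda>n. A (real n))"
    unfolding Cauchy_def by (meson le_less_trans)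
  then obtain I where I: "(\<lambda>n. A (real n)) \<longlonglongrightarrow> I"
    using Cauchy_convergent convergent_def by blast
  show ?thesis
  proof (rule that[of "\<lambda>s. I - A s"])
    fix s
    show "((\<lambda>s. I - A s) has_real_derivative - F s) (at s)"
      by (auto intro!: derivative_eq_intros A)
    assume s: "s \<ge> 0"
    have "\<bar>I - A s\<bar> \<le> M * E s - M * 0"
    proof (rule tendsto_le[OF sequentially_bot])
      show "(\<lambda>n. M * E s - M * E (real n)) \<longlonglongrightarrow> M * E s - M * 0"
        by (intro tendsto_intros Elim)
      show "(\<lambda>n. \<bar>A (real n) - A s\<bar>) \<longlonglongrightarrow> \<bar>I - A s\<bar>"
        by (intro tendsto_intros I)
      show "\<forall>\<^sub>F n in sequentially. \<bar>A (real n) - A s\<bar> \<le> M * E s - M * E (real n)"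
        using eventually_ge_at_top[of "nat \<lceil>s\<rceil>"] by eventually_elim (use dom s in \<open>simp add: nat_le_iff ceiling_le_iff\<close>)
    qed
    then show "\<bar>I - A s\<bar> \<le> M * E s" by simp
  qed
qed

text \<open>Comparison with the positive solution \<open>g\<close> replaces a Green's function estimate: since
  \<open>(Q + \<nu>) g - g'' = \<nu> g\<close>, the resolvent maps \<open>{f. \<bar>f\<bar> \<le> M g}\<close> into \<open>{u. \<bar>u\<bar> \<le> (M / \<nu>) g}\<close>.
  The decaying solution \<open>p\<close> serves for the reduction of order \<open>u = p y\<close>.\<close>

lemma weighted_resolvent:
  fixes g g' p p' f Q :: "real \<Rightarrow> real"
  assumes nu: "\<nu> > 0" and M: "M \<ge> 0"
    and g: "\<And>s. (g has_real_derivative g' s) (at s)" "\<And>s. (g' has_real_derivative Q s * g s) (at s)"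
    and p: "\<And>s. (p has_real_derivative p' s) (at s)"
      "\<And>s. (p' has_real_derivative (Q s + \<nu>) * p s) (at s)"
    and pos: "\<And>s. g s > 0" "\<And>s. p s > 0"
    and lim: "((\<lambda>s. p s * g' s - p' s * g s) \<longlongrightarrow> 0) at_top"
    and f: "continuous_on UNIV f" "\<And>s. s \<ge> 0 \<Longrightarrow> \<bar>f s\<bar> \<le> M * g s"
  obtains u u' where "\<And>s. (u has_real_derivative u' s) (at s)"
    "\<And>s. (u' has_real_derivative (Q s + \<nu>) * u s - f s) (at s)"
    "u' 0 * g 0 = u 0 * g' 0" "\<And>s. s \<ge> 0 \<Longrightarrow> \<bar>u s\<bar> \<le> M / \<nu> * g s"
proof -
  \<comment> \<open>\<open>E\<close> is the Wronskian of \<open>p\<close> and \<open>g\<close>. Its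
    derivative is \<open>- \<nu> p g\<close> and its limit is 0, so it is the tail integral of
    \<open>\<nu> p g\<close> and positive.\<close>
  define E where "E = (\<lambda>s. p s * g' s - p' s * g s)"
  have E': "(E has_real_derivative - (\<nu> * p s * g s)) (at s)" for s
    unfolding E_def by (auto intro!: derivative_eq_intros g p simp: algebra_simps)
  have Elim: "(E \<longlongrightarrow> 0) at_top"
    using lim by (simp add: E_def)
  have cont: "continuous_on UNIV p" "continuous_on UNIV g"
    using p(1) g(1) by (auto intro!: DERIV_continuous_on)
  \<comment> \<open>\<open>P\<close> is the tail integral of \<open>p f\<close>, dominated by that
    of \<open>M p g\<close>, which is \<open>M / \<nu> * E\<close>.\<close>
  obtain P where P: "\<And>s. (P has_real_derivative - (p s * f s)) (at s)"
    and Pb: "\<And>s. s \<ge> 0 \<Longrightarrow> \<bar>P s\<bar> \<le> M / \<nu> * E s"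
  proof (rule decaying_antiderivative[OF _ E' Elim])
    show "continuous_on UNIV (\<lambda>s. p s * f s)"
      by (intro continuous_intros cont f)
    show "\<bar>p s * f s\<bar> \<le> M / \<nu> * (\<nu> * p s * g s)" if "s \<ge> 0" for s
      using mult_left_mono[OF f(2)[OF that], of "p s"] pos(2)[of s] nu by (simp add: abs_mult mult_ac)
  qed auto
  have E0: "E 0 > 0"
  proof -
    have "E 1 < E 0"
      by (rule DERIV_neg_imp_decreasing) (use E' pos nu in \<open>auto intro!: exI\<close>)
    moreover have "0 \<le> E 1"
    proof (rule tendsto_upperbound[OF Elim _ trivial_limit_at_top_linorder])
      have "E s \<le> E 1" if "s \<ge> 1" for s
        by (rule DERIV_nonpos_imp_nonincreasing[OF that])
          (use E' pos nu in \<open>force intro!: exI mult_nonneg_nonneg less_imp_le\<close>)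
      then show "\<forall>\<^sub>F s in at_top. E s \<le> E 1"
        by (auto intro: eventually_mono[OF eventually_ge_at_top[of 1]])
    qed
    ultimately show ?thesis by linarith
  qed
  have contP: "continuous_on UNIV P"
    using P by (auto intro!: DERIV_continuous_on)
  \<comment> \<open>For \<open>u = p y\<close> the equation becomes
    \<open>(p\<^sup>2 y')' = - p f\<close>, whence \<open>y' = P / p\<^sup>2\<close>.\<close>
  have "continuous_on UNIV (\<lambda>s. P s / (p s)\<^sup>2)"
    using pos(2) by (intro continuous_intros cont contP) (simp add: less_imp_neq[symmetric])
  then obtain Y where Y: "\<And>s. (Y has_real_derivative P s / (p s)\<^sup>2) (at s)"
    using has_antiderivative by blast
  have pn: "p s \<noteq> 0" for s
    using pos(2)[of s] by simp
  \<comment> \<open>The derivative of \<open>g / p\<close> is \<open>E / p\<^sup>2\<close>, so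
    \<open>M / \<nu> * (g / p)\<close> is an explicit antiderivative of the majorant of
    \<open>P / p\<^sup>2\<close>.\<close>
  have gp: "((\<lambda>s. M / \<nu> * (g s / p s)) has_real_derivative M / \<nu> * (E s / (p s)\<^sup>2)) (at s)" for s
    using pn[of s] nu by (auto intro!: derivative_eq_intros g p simp: E_def power2_eq_square field_simps)
  have Yb: "\<bar>Y s - Y 0\<bar> \<le> M / \<nu> * (g s / p s) - M / \<nu> * (g 0 / p 0)" if "s \<ge> 0" for s
  proof (rule deriv_dominated[OF Y gp])
    show "\<bar>P s / (p s)\<^sup>2\<bar> \<le> M / \<nu> * (E s / (p s)\<^sup>2)" if "s \<ge> 0" for s
      using divide_right_mono[OF Pb[OF that], of "(p s)\<^sup>2"] by simp
  qed (use that in auto)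
  \<comment> \<open>The Robin condition at 0 forces this value of \<open>y\<close>. The bound on it
    cancels the negative boundary term in \<open>Yb\<close>.\<close>
  define y0 where "y0 = P 0 * g 0 / (p 0 * E 0)"
  have y0b: "\<bar>y0\<bar> \<le> M / \<nu> * (g 0 / p 0)"
  proof -
    have "\<bar>y0\<bar> = \<bar>P 0\<bar> * (g 0 / (p 0 * E 0))"
      using pos(1)[of 0] pos(2)[of 0] E0 by (simp add: y0_def abs_mult)
    also have "\<dots> \<le> (M / \<nu> * E 0) * (g 0 / (p 0 * E 0))"
      using pos(1)[of 0] pos(2)[of 0] E0 Pb[of 0] by (intro mult_right_mono) auto
    finally show ?thesis
      using E0 by simp
  qed
  define y where "y = (\<lambda>s. y0 + (Y s - Y 0))"
  have y': "(y has_real_derivative P s / (p s)\<^sup>2) (at s)" for s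
    unfolding y_def by (auto intro!: derivative_eq_intros Y)
  show ?thesis
  proof (rule that[of "\<lambda>s. p s * y s" "\<lambda>s. p' s * y s + P s / p s"])
    fix s
    show "((\<lambda>s. p s * y s) has_real_derivative p' s * y s + P s / p s) (at s)"
      using pn[of s] by (auto intro!: derivative_eq_intros p y' simp: power2_eq_square)
    show "((\<lambda>s. p' s * y s + P s / p s) has_real_derivative (Q s + \<nu>) * (p s * y s) - f s) (at s)"
      using pn[of s] by (auto intro!: derivative_eq_intros p y' P simp: power2_eq_square field_simps)
    assume s: "s \<ge> 0"
    have "\<bar>y s\<bar> \<le> M / \<nu> * (g s / p s)"
      using Yb[OF s] y0b unfolding y_def by linarith
    then have "p s * \<bar>y s\<bar> \<le> p s * (M / \<nu> * (g s / p s))"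
      using pos(2)[of s] by (intro mult_left_mono) auto
    then show "\<bar>p s * y s\<bar> \<le> M / \<nu> * g s"
      using pos(2)[of s] by (simp add: abs_mult)
  next
    have "p 0 * E 0 \<noteq> 0" using pn E0 by simp
    then have "y0 * E 0 = P 0 * g 0 / p 0"
      by (simp add: y0_def)
    then show "(p' 0 * y 0 + P 0 / p 0) * g 0 = p 0 * y 0 * g' 0"
      by (simp add: y_def E_def algebra_simps)
  qed
qed

text \<open>For the sums of the series the recursions say \<open>S' = u' C\<close> and
  \<open>C' = - u' S\<close>, equations that sine and cosine of the sum of \<open>u\<close> satisfy
  with the same initial values. The sum \<open>D\<close> of the two squared differences therefore
  has derivative zero and vanishes at 0.\<close>

lemma sin_cos_power_series:
  fixes u C S :: "nat \<Rightarrow> real"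
  assumes b: "\<And>n. \<bar>u n\<bar> \<le> K / 2 ^ n" "\<And>n. \<bar>C n\<bar> \<le> K / 2 ^ n" "\<And>n. \<bar>S n\<bar> \<le> K / 2 ^ n"
    and init: "S 0 = sin (u 0)" "C 0 = cos (u 0)"
    and S: "\<And>n. real n * S n = (\<Sum>k=1..n. real k * u k * C (n - k))"
    and C: "\<And>n. real n * C n = - (\<Sum>k=1..n. real k * u k * S (n - k))"
    and z: "0 \<le> z" "z \<le> 1"
  shows "(\<Sum>n. S n * z ^ n) = sin (\<Sum>n. u n * z ^ n)"
proof -
  \<comment> \<open>Coefficients of size \<open>K / 2 ^ n\<close> allow radii up to 2; the
    intermediate radius 3/2 keeps z = 1 in the interior of the interval used.\<close>
  have summ: "summable (\<lambda>n. v n * (3/2) ^ n)" if "\<And>n. \<bar>v n\<bar> \<le> K / 2 ^ n" for v :: "nat \<Rightarrow> real"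
  proof (rule summable_comparison_test')
    show "summable (\<lambda>n. K * (3/4) ^ n)"
      by (intro summable_mult summable_geometric) auto
    show "norm (v n * (3/2) ^ n) \<le> K * (3/4) ^ n" for n
    proof -
      have "norm (v n * (3/2) ^ n) \<le> K / 2 ^ n * (3/2) ^ n"
        using mult_right_mono[OF that[of n], of "(3/2) ^ n"] by (simp add: abs_mult)
      also have "\<dots> = K * (3/4) ^ n"
        by (simp add: power_divide flip: power_mult_distrib)
      finally show ?thesis .
    qed
  qed
  define ev where "ev = (\<lambda>(v :: nat \<Rightarrow> real) x. \<Sum>n. v n * x ^ n)"
  have deriv: "(ev v has_real_derivative ev (diffs v) x) (at x)"
    if "\<And>n. \<bar>v n\<bar> \<le> K / 2 ^ n" "\<bar>x\<bar> < 3/2" for v x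
    unfolding ev_def using that by (intro termdiffs_strong[OF summ]) auto
  have abs1: "summable (\<lambda>n. norm (v n * x ^ n))" if "\<And>n. \<bar>v n\<bar> \<le> K / 2 ^ n" "\<bar>x\<bar> < 3/2" for v x
    using that by (intro powser_insidea[OF summ]) auto
  have abs2: "summable (\<lambda>n. norm (diffs v n * x ^ n))" if v: "\<And>n. \<bar>v n\<bar> \<le> K / 2 ^ n" and x: "\<bar>x\<bar> < 3/2"
    for v x
  proof -
    obtain r where r: "\<bar>x\<bar> < r" "r < 3/2" using x dense by blast
    have "summable (\<lambda>n. diffs v n * r ^ n)"
    proof (rule termdiff_converges[where K = "3/2"])
      show "summable (\<lambda>n. v n * y ^ n)" if "norm y < 3/2" for y
        using abs1[of v y] v that summable_norm_cancel by fastforce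
    qed (use r in auto)
    then show ?thesis
      using r by (intro powser_insidea[where x = r]) auto
  qed
  \<comment> \<open>The Cauchy product of \<open>u'\<close> and \<open>v\<close> has the coefficient
    \<open>Suc n * w (Suc n)\<close> at index n: the shift turns the recursion into
    \<open>w' = u' v\<close>.\<close>
  have prod: "ev (\<lambda>n. real (Suc n) * w (Suc n)) x = ev (diffs u) x * ev v x"
    if v: "\<And>n. \<bar>v n\<bar> \<le> K / 2 ^ n" and x: "\<bar>x\<bar> < 3/2"
      and w: "\<And>n. real n * w n = (\<Sum>k=1..n. real k * u k * v (n - k))" for v w x
  proof -
    have "(\<lambda>k. \<Sum>i\<le>k. (diffs u i * x ^ i) * (v (k - i) * x ^ (k - i))) sums (ev (diffs u) x * ev v x)"
      unfolding ev_def by (rule Cauchy_product_sums[OF abs2[OF b(1) x] abs1[OF v x]])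
    also have "(\<lambda>k. \<Sum>i\<le>k. (diffs u i * x ^ i) * (v (k - i) * x ^ (k - i)))
        = (\<lambda>n. real (Suc n) * w (Suc n) * x ^ n)"
    proof
      fix n
      have "(\<Sum>i\<le>n. (diffs u i * x ^ i) * (v (n - i) * x ^ (n - i))) = (\<Sum>i\<le>n. diffs u i * v (n - i)) * x ^ n"
        unfolding sum_distrib_right
        by (intro sum.cong) (auto simp: power_add[symmetric] mult_ac)
      also have "(\<Sum>i\<le>n. diffs u i * v (n - i)) = (\<Sum>i=0..n. real (Suc i) * u (Suc i) * v (Suc n - Suc i))"
        by (intro sum.cong) (auto simp: diffs_def)
      also have "\<dots> = (\<Sum>k=1..Suc n. real k * u k * v (Suc n - k))"
        using sum.shift_bounds_cl_Suc_ivl[of "\<lambda>k. real k * u k * v (Suc n - k)" 0 n] by simp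
      finally show "(\<Sum>i\<le>n. (diffs u i * x ^ i) * (v (n - i) * x ^ (n - i))) = real (Suc n) * w (Suc n) * x ^ n"
        using w[of "Suc n"] by simp
    qed
    finally show ?thesis
      by (simp add: ev_def sums_iff)
  qed
  have S': "(ev S has_real_derivative ev (diffs u) x * ev C x) (at x)" if "\<bar>x\<bar> < 3/2" for x
    using deriv[OF b(3) that] prod[OF b(2) that S] by (simp add: diffs_def)
  have C': "(ev C has_real_derivative - (ev (diffs u) x * ev S x)) (at x)" if "\<bar>x\<bar> < 3/2" for x
  proof -
    have "real n * (- C n) = (\<Sum>k=1..n. real k * u k * S (n - k))" for n
      using C[of n] by simp
    from prod[OF b(3) that this] have "ev (diffs C) x = - (ev (diffs u) x * ev S x)"
      using suminf_minus[OF summable_norm_cancel[OF abs2[OF b(2) that]]] by (simp add: diffs_def ev_def)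
    then show ?thesis
      using deriv[OF b(2) that] by simp
  qed
  have u': "(ev u has_real_derivative ev (diffs u) x) (at x)" if "\<bar>x\<bar> < 3/2" for x
    by (rule deriv[OF b(1) that])
  define D where "D = (\<lambda>x. (ev S x - sin (ev u x))\<^sup>2 + (ev C x - cos (ev u x))\<^sup>2)"
  have "(D has_real_derivative 0) (at x)" if "\<bar>x\<bar> < 3/2" for x
    unfolding D_def using that
    by (auto intro!: derivative_eq_intros S' C' u' simp: algebra_simps power2_eq_square)
  then have "D z = D 0"
    using z by (intro DERIV_isconst3[of "-3/2" "3/2"]) auto
  also have "D 0 = 0"
    by (simp add: D_def ev_def init)
  finally show ?thesis
    by (simp add: D_def ev_def add_nonneg_eq_0_iff)
qed

section \<open>Kink profile, Jost solutions and the mode recursion\<close>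

definition psi :: "real \<Rightarrow> real \<Rightarrow> real" where
  "psi s0 s = 4 * arctan (exp (s0 - s))"

text \<open>With \<open>q = exp (s0 - s)\<close> the angle is four times \<open>arctan q\<close>, so
  the double-angle formulas are applied twice. The potential equals 1 minus twice the squared
  hyperbolic secant of s - s0.\<close>

lemma cos_psi: "cos (psi s0 s) = 2 * (tanh (s - s0))\<^sup>2 - 1"
  and sin_psi: "sin (psi s0 s) = 2 * tanh (s - s0) / cosh (s - s0)"
proof -
  define q where "q = exp (s0 - s)"
  have q: "q > 0" by (simp add: q_def)
  have q2: "q\<^sup>2 = exp (- 2 * (s - s0))"
    by (simp add: q_def algebra_simps flip: exp_double)
  have pos: "1 + q\<^sup>2 > 0" by (simp add: add_pos_nonneg)
  have sq: "(sqrt (1 + q\<^sup>2))\<^sup>2 = 1 + q\<^sup>2" by simp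
  have t: "tanh (s - s0) = (1 - q\<^sup>2) / (1 + q\<^sup>2)"
    by (simp add: tanh_real_altdef q2)
  have "exp (s - s0) = 1 / q"
    by (simp add: q_def exp_minus[symmetric] inverse_eq_divide[symmetric])
  then have c: "cosh (s - s0) = (1 + q\<^sup>2) / (2 * q)"
    using q by (simp add: cosh_def q_def[symmetric] field_simps power2_eq_square)
  have c2: "cos (2 * arctan q) = (1 - q\<^sup>2) / (1 + q\<^sup>2)"
    using pos by (simp add: cos_double cos_arctan sin_arctan power_divide sq diff_divide_distrib)
  have s2: "sin (2 * arctan q) = 2 * q / (1 + q\<^sup>2)"
    using pos by (simp add: sin_double cos_arctan sin_arctan flip: power2_eq_square)
  have dbl: "psi s0 s = 2 * (2 * arctan q)" by (simp add: psi_def q_def)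
  show "cos (psi s0 s) = 2 * (tanh (s - s0))\<^sup>2 - 1"
    unfolding dbl cos_double_cos[of "2 * arctan q"] c2 t ..
  show "sin (psi s0 s) = 2 * tanh (s - s0) / cosh (s - s0)"
    unfolding dbl sin_double[of "2 * arctan q"] c2 s2 t c using q pos by (simp add: field_simps)
qed

definition psi1 :: "real \<Rightarrow> real \<Rightarrow> real" where
  "psi1 s0 s = - 2 / cosh (s - s0)"

lemma cosh_exp_shift: "(1 + (exp (s0 - s))\<^sup>2) * inverse (cosh (s - s0)) = 2 * exp (s0 - s)" for s0 s :: real
proof -
  have "exp (s - s0) * exp (s0 - s) = 1" by (simp flip: exp_add)
  then have "2 * exp (s0 - s) * cosh (s - s0) = 1 + (exp (s0 - s))\<^sup>2"
    by (simp add: cosh_def algebra_simps power2_eq_square)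
  then show ?thesis by (simp add: field_simps)
qed

lemma psi_deriv: "(psi s0 has_real_derivative psi1 s0 s) (at s)"
proof -
  have "1 + (exp (s0 - s))\<^sup>2 \<noteq> 0"
    by (metis add_pos_nonneg less_irrefl zero_le_power2 zero_less_one)
  moreover have "psi1 s0 s = 4 * (- exp (s0 - s) / (1 + (exp (s0 - s))\<^sup>2))"
    using calculation cosh_exp_shift[of s0 s] by (simp add: psi1_def field_simps)
  ultimately show ?thesis
    unfolding psi_def by (auto intro!: derivative_eq_intros simp: field_simps)
qed

lemma psi1_deriv: "(psi1 s0 has_real_derivative sin (psi s0 s)) (at s)"
  unfolding psi1_def sin_psi
  by (auto intro!: derivative_eq_intros simp: tanh_def power2_eq_square)

lemma psi_bounds: "0 < psi s0 s" "psi s0 s \<le> 4 * exp s0 * exp (- s)"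
proof -
  have "arctan (exp (s0 - s)) \<le> exp (s0 - s)"
    by (intro arctan_le_self) simp
  then show "psi s0 s \<le> 4 * exp s0 * exp (- s)"
    by (simp add: psi_def exp_diff exp_minus field_simps)
qed (simp add: psi_def)

text \<open>The image of \<open>exp (- k * s)\<close> under the operator
  \<open>tanh (s - s0) - d/ds\<close>, the Darboux transformation from the free equation to the one
  with potential \<open>cos \<psi>\<close>.\<close>

definition jost :: "real \<Rightarrow> real \<Rightarrow> real \<Rightarrow> real" where
  "jost s0 k s = exp (- k * s) * (k + tanh (s - s0))"

definition jost1 :: "real \<Rightarrow> real \<Rightarrow> real \<Rightarrow> real" where
  "jost1 s0 k s = exp (- k * s) * (1 - (tanh (s - s0))\<^sup>2 - k * (k + tanh (s - s0)))"

lemma jost_deriv: "(jost s0 k has_real_derivative jost1 s0 k s) (at s)"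
  unfolding jost_def jost1_def
  by (auto intro!: derivative_eq_intros simp: algebra_simps power2_eq_square)

lemma jost1_deriv: "(jost1 s0 k has_real_derivative (cos (psi s0 s) + (k\<^sup>2 - 1)) * jost s0 k s) (at s)"
  unfolding jost_def jost1_def cos_psi
  by (auto intro!: derivative_eq_intros simp: algebra_simps power2_eq_square)

lemma jost_pos:
  assumes "k > 1"
  shows "0 < jost s0 k s"
  using assms tanh_real_gt_neg1[of "s - s0"] by (auto simp: jost_def intro!: mult_pos_pos)

lemma jost_le:
  assumes "k > 1" "s \<ge> 0"
  shows "jost s0 k s \<le> (k + 1) * exp (- s)"
proof -
  have "exp (- k * s) \<le> exp (- s)"
    using assms by (simp add: mult_le_cancel_right1)
  then have "exp (- k * s) * (k + tanh (s - s0)) \<le> exp (- s) * (k + 1)"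
    using assms tanh_real_lt_1[of "s - s0"] tanh_real_gt_neg1[of "s - s0"] by (intro mult_mono) auto
  then show ?thesis by (simp add: jost_def mult.commute)
qed

lemma jost_tendsto_0:
  assumes "k > 0"
  shows "(jost s0 k \<longlongrightarrow> 0) at_top" "(jost1 s0 k \<longlongrightarrow> 0) at_top"
proof -
  have e: "((\<lambda>s. exp (- k * s)) \<longlongrightarrow> 0) at_top"
    by (intro filterlim_compose[OF exp_at_bot] filterlim_tendsto_neg_mult_at_bot[OF tendsto_const] filterlim_ident)
      (use assms in auto)
  have "filterlim (\<lambda>s. s + - s0) at_top at_top"
    by (subst add.commute) (intro filterlim_tendsto_add_at_top[OF tendsto_const] filterlim_ident)
  then have t: "((\<lambda>s. tanh (s - s0)) \<longlongrightarrow> 1) at_top"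
    using filterlim_compose[OF tanh_real_at_top] by simp
  have "((\<lambda>s. exp (- k * s) * (k + tanh (s - s0))) \<longlongrightarrow> 0 * (k + 1)) at_top"
    by (intro tendsto_intros e t)
  then show "(jost s0 k \<longlongrightarrow> 0) at_top" by (simp add: jost_def[abs_def])
  have "((\<lambda>s. exp (- k * s) * (1 - (tanh (s - s0))\<^sup>2 - k * (k + tanh (s - s0)))) \<longlongrightarrow> 0 * (1 - 1\<^sup>2 - k * (k + 1))) at_top"
    by (intro tendsto_intros e t)
  then show "(jost1 s0 k \<longlongrightarrow> 0) at_top" by (simp add: jost1_def[abs_def])
qed

text \<open>The mean value theorem on [s, s + 1] yields a point where \<open>u1\<close> is at most
  \<open>2 * B * exp (- s)\<close> in absolute value; going back from there to s costs at most
  another \<open>B * exp (- s)\<close>.\<close>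

lemma interpolation_exp_bound:
  fixes u u1 u2 :: "real \<Rightarrow> real"
  assumes "\<And>x. (u has_real_derivative u1 x) (at x)" "\<And>x. (u1 has_real_derivative u2 x) (at x)"
    and b: "\<And>x. x \<ge> 0 \<Longrightarrow> \<bar>u x\<bar> \<le> B * exp (- x)" "\<And>x. x \<ge> 0 \<Longrightarrow> \<bar>u2 x\<bar> \<le> B * exp (- x)"
    and s: "s \<ge> 0"
  shows "\<bar>u1 s\<bar> \<le> 3 * B * exp (- s)"
proof -
  have B: "B \<ge> 0" using b(1)[of 0] by simp
  have mono: "B * exp (- x) \<le> B * exp (- s)" if "x \<ge> s" for x
    using B that by (intro mult_left_mono) auto
  obtain \<xi> where \<xi>: "s < \<xi>" "\<xi> < s + 1" "u (s + 1) - u s = (s + 1 - s) * u1 \<xi>"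
    using MVT2[of s "s + 1" u u1] assms by auto
  obtain \<eta> where \<eta>: "s < \<eta>" "\<eta> < \<xi>" "u1 \<xi> - u1 s = (\<xi> - s) * u2 \<eta>"
    using MVT2[of s \<xi> u1 u2] assms \<xi> by auto
  have "\<bar>(\<xi> - s) * u2 \<eta>\<bar> \<le> 1 * (B * exp (- s))"
    unfolding abs_mult using b(2)[of \<eta>] mono[of \<eta>] \<xi> \<eta> s by (intro mult_mono) auto
  then show ?thesis
    using \<xi> \<eta> b(1)[of s] b(1)[of "s + 1"] mono[of "s + 1"] s by auto
qed

section \<open>The unstable mode and the recursion for the higher modes\<close>

locale kink_mode =
  fixes s0 \<kappa> :: real
  assumes kappa: "\<kappa> > 1"
begin

definition \<mu> :: real where "\<mu> = sqrt (\<kappa>\<^sup>2 - 1)"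

text \<open>Small enough that \<open>2 * amp * (\<kappa> + 1)\<close> is at most 1, which closes the
  bounds on \<open>cc\<close> and \<open>sc\<close>, and at most \<open>\<mu>\<^sup>2\<close>, which
  closes the bound on \<open>uc\<close>.\<close>

definition amp :: real where "amp = min 1 (\<mu>\<^sup>2) / (2 * (\<kappa> + 1))"

abbreviation g :: "real \<Rightarrow> real" where "g \<equiv> jost s0 \<kappa>"
abbreviation g1 :: "real \<Rightarrow> real" where "g1 \<equiv> jost1 s0 \<kappa>"

lemma kappa_sq: "\<kappa>\<^sup>2 > 1"
  using kappa by (simp add: one_less_power)

lemma mu_sq: "\<mu>\<^sup>2 = \<kappa>\<^sup>2 - 1"
  using kappa_sq by (simp add: \<mu>_def)

lemma mu_pos: "\<mu> > 0"
  using kappa_sq by (simp add: \<mu>_def)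

lemma amp_pos: "amp > 0"
  using kappa mu_pos by (simp add: amp_def)

lemma amp_le: "2 * amp * (\<kappa> + 1) \<le> 1" "2 * amp * (\<kappa> + 1) \<le> \<mu>\<^sup>2"
proof -
  have "2 * amp * (\<kappa> + 1) = amp * (2 * (\<kappa> + 1))" by simp
  also have "\<dots> = min 1 (\<mu>\<^sup>2)"
    unfolding amp_def using kappa by (intro nonzero_eq_divide_eq[THEN iffD1]) auto
  finally show "2 * amp * (\<kappa> + 1) \<le> 1" "2 * amp * (\<kappa> + 1) \<le> \<mu>\<^sup>2" by auto
qed

lemma g_pos: "g s > 0"
  using jost_pos kappa .

lemma g_le: "s \<ge> 0 \<Longrightarrow> g s \<le> (\<kappa> + 1) * exp (- s)" "s \<ge> 0 \<Longrightarrow> g s \<le> \<kappa> + 1"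
proof -
  assume s: "s \<ge> 0"
  show "g s \<le> (\<kappa> + 1) * exp (- s)"
    using jost_le[OF kappa s] .
  also have "\<dots> \<le> (\<kappa> + 1) * 1"
    using kappa s by (intro mult_left_mono) auto
  finally show "g s \<le> \<kappa> + 1" by simp
qed

text \<open>This is the z^n coefficient of the sine-Gordon equation for z =
  \<open>exp (\<mu> * \<tau>)\<close>, with \<open>f\<close> the part of the sine coming from lower
  modes. The Robin condition is expressed through the boundary values of \<open>g\<close>, so its
  parameter does not enter. In the bound, 1/n absorbs the weight k of the convolutions and
  \<open>2 ^ n\<close> leaves room beyond z = 1.\<close>

definition mode_eq :: "nat \<Rightarrow> (real \<Rightarrow> real) \<Rightarrow> (real \<Rightarrow> real) \<Rightarrow> (real \<Rightarrow> real) \<Rightarrow> bool" where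
  "mode_eq n f u u' \<longleftrightarrow> (\<forall>s. (u has_real_derivative u' s) (at s)) \<and>
     (\<forall>s. (u' has_real_derivative (cos (psi s0 s) + (real n)\<^sup>2 * \<mu>\<^sup>2) * u s + f s) (at s)) \<and>
     u' 0 * g 0 = u 0 * g1 0 \<and> (\<forall>s\<ge>0. \<bar>u s\<bar> \<le> amp / (real n * 2 ^ n) * g s)"

lemma mode_eq_solvable:
  assumes n: "n \<ge> 2" and f: "continuous_on UNIV f"
    and fb: "\<And>s. s \<ge> 0 \<Longrightarrow> \<bar>f s\<bar> \<le> 2 * amp\<^sup>2 * (\<kappa> + 1) / 2 ^ n * g s"
  shows "\<exists>u u'. mode_eq n f u u'"
proof -
  \<comment> \<open>Then \<open>k\<^sup>2 - 1 = n\<^sup>2 \<mu>\<^sup>2\<close>, so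
    \<open>jost s0 k\<close> is the decaying homogeneous solution for mode n; \<open>\<nu>\<close>
    is the gap between this equation and that of \<open>g\<close>.\<close>
  define k where "k = sqrt (1 + (real n)\<^sup>2 * \<mu>\<^sup>2)"
  define \<nu> where "\<nu> = ((real n)\<^sup>2 - 1) * \<mu>\<^sup>2"
  define M where "M = 2 * amp\<^sup>2 * (\<kappa> + 1) / 2 ^ n"
  have k2: "k\<^sup>2 = 1 + (real n)\<^sup>2 * \<mu>\<^sup>2"
    by (simp add: k_def add_nonneg_nonneg)
  have k1: "k > 1"
    using n mu_pos by (simp add: k_def)
  \<comment> \<open>Here n >= 2 enters: the factor \<open>n\<^sup>2 - 1\<close> of the gap supplies
    the gain 1/n demanded by \<open>mode_eq\<close>.\<close>
  have n2: "real n \<le> (real n)\<^sup>2 - 1"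
  proof -
    have "real n * 2 \<le> real n * real n"
      using n by (intro mult_left_mono) auto
    moreover have "real n \<ge> 2" using n by simp
    ultimately show ?thesis unfolding power2_eq_square by linarith
  qed
  have nu: "\<nu> > 0"
    using n n2 mu_pos by (auto simp: \<nu>_def intro!: mult_pos_pos)
  have lim: "((\<lambda>s. jost s0 k s * g1 s - jost1 s0 k s * g s) \<longlongrightarrow> 0 * 0 - 0 * 0) at_top"
    using k1 kappa by (intro tendsto_intros jost_tendsto_0) auto
  obtain u u' where u: "\<And>s. (u has_real_derivative u' s) (at s)"
    "\<And>s. (u' has_real_derivative ((cos (psi s0 s) + (\<kappa>\<^sup>2 - 1)) + \<nu>) * u s - (- f s)) (at s)"
    "u' 0 * g 0 = u 0 * g1 0" "\<And>s. s \<ge> 0 \<Longrightarrow> \<bar>u s\<bar> \<le> M / \<nu> * g s"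
  proof (rule weighted_resolvent[OF nu _ jost_deriv jost1_deriv jost_deriv[of s0 k], where M = M and f = "\<lambda>s. - f s"])
    show "0 \<le> M" using kappa by (simp add: M_def)
    show "(jost1 s0 k has_real_derivative (cos (psi s0 s) + (\<kappa>\<^sup>2 - 1) + \<nu>) * jost s0 k s) (at s)" for s
      using jost1_deriv[of s0 k s] by (simp add: k2 \<nu>_def mu_sq algebra_simps)
    show "0 < jost s0 k s" for s by (rule jost_pos[OF k1])
  qed (use fb f lim g_pos in \<open>auto simp: M_def intro!: continuous_intros\<close>)
  have eq: "((cos (psi s0 s) + (\<kappa>\<^sup>2 - 1)) + \<nu>) = cos (psi s0 s) + (real n)\<^sup>2 * \<mu>\<^sup>2" for s
    by (simp add: \<nu>_def mu_sq algebra_simps)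
  have Mb: "M / \<nu> \<le> amp / (real n * 2 ^ n)"
  proof -
    have "M * (real n * 2 ^ n) = (2 * amp * (\<kappa> + 1)) * real n * amp"
      by (simp add: M_def power2_eq_square)
    also have "\<dots> \<le> \<mu>\<^sup>2 * ((real n)\<^sup>2 - 1) * amp"
      using amp_le(2) n2 amp_pos by (intro mult_right_mono mult_mono) auto
    finally have "M * (real n * 2 ^ n) \<le> amp * \<nu>"
      by (simp add: \<nu>_def mult_ac)
    then show ?thesis
      using nu n by (simp add: field_simps)
  qed
  have "\<bar>u s\<bar> \<le> amp / (real n * 2 ^ n) * g s" if "s \<ge> 0" for s
    using u(4)[OF that] mult_right_mono[OF Mb, of "g s"] g_pos[of s] by simp
  then have "mode_eq n f u u'"
    using u unfolding mode_eq_def eq by auto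
  then show ?thesis by blast
qed

text \<open>The \<open>n\<close>-th step produces the \<open>z\<^sup>n\<close>-coefficients of \<open>U\<close>, \<open>cos U\<close> and \<open>sin U\<close>; the last two are
  determined by \<open>z (sin U)' = z U' cos U\<close> and \<open>z (cos U)' = - z U' sin U\<close>, and \<open>f\<close>, \<open>e\<close> are the parts of these
  convolutions that involve lower coefficients only.\<close>

definition coeff_step :: "nat \<Rightarrow> (real \<Rightarrow> real) \<Rightarrow> (real \<Rightarrow> real) \<Rightarrow> (real \<Rightarrow> real) \<times> (real \<Rightarrow> real) \<times> (real \<Rightarrow> real)" where
  "coeff_step n f e =
     (if n = 0 then (psi s0, \<lambda>s. cos (psi s0 s), \<lambda>s. sin (psi s0 s))
      else let u = (if n = 1 then (\<lambda>s. amp / 2 * g s) else (SOME u. \<exists>u'. mode_eq n f u u'))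
        in (u, \<lambda>s. - (u s * sin (psi s0 s) + e s), \<lambda>s. u s * cos (psi s0 s) + f s))"

text \<open>The three families are coupled and hence built as one triple; for k in
  \<open>{1..<n}\<close> both k and n - k are smaller than n.\<close>

fun coeffs :: "nat \<Rightarrow> (real \<Rightarrow> real) \<times> (real \<Rightarrow> real) \<times> (real \<Rightarrow> real)" where
  "coeffs n = coeff_step n
     (\<lambda>s. (\<Sum>k\<in>{1..<n}. real k * fst (coeffs k) s * fst (snd (coeffs (n - k))) s) / real n)
     (\<lambda>s. (\<Sum>k\<in>{1..<n}. real k * fst (coeffs k) s * snd (snd (coeffs (n - k))) s) / real n)"

declare coeffs.simps [simp del]

definition uc :: "nat \<Rightarrow> real \<Rightarrow> real" where "uc n = fst (coeffs n)"
definition cc :: "nat \<Rightarrow> real \<Rightarrow> real" where "cc n = fst (snd (coeffs n))"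
definition sc :: "nat \<Rightarrow> real \<Rightarrow> real" where "sc n = snd (snd (coeffs n))"

definition low_conv :: "(nat \<Rightarrow> real \<Rightarrow> real) \<Rightarrow> nat \<Rightarrow> real \<Rightarrow> real" where
  "low_conv v n s = (\<Sum>k\<in>{1..<n}. real k * uc k s * v (n - k) s) / real n"

lemma coeffs_step: "coeffs n = coeff_step n (low_conv cc n) (low_conv sc n)"
  by (subst coeffs.simps) (simp add: low_conv_def[abs_def] uc_def cc_def sc_def)

lemma coeff_0: "uc 0 = psi s0" "cc 0 s = cos (psi s0 s)" "sc 0 s = sin (psi s0 s)"
  by (simp_all add: uc_def cc_def sc_def coeffs_step coeff_step_def)

lemma uc_1: "uc (Suc 0) = (\<lambda>s. amp / 2 * g s)"
  by (simp add: uc_def coeffs_step coeff_step_def)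

lemma uc_some: "n \<ge> 2 \<Longrightarrow> uc n = (SOME u. \<exists>u'. mode_eq n (low_conv cc n) u u')"
  by (simp add: uc_def coeffs_step coeff_step_def Let_def)

lemma cc_sc:
  assumes "n \<ge> 1"
  shows "cc n s = - (uc n s * sin (psi s0 s) + low_conv sc n s)"
    "sc n s = uc n s * cos (psi s0 s) + low_conv cc n s"
  using assms by (simp_all add: uc_def cc_def sc_def coeffs_step[of n] coeff_step_def Let_def)

lemma cont_psi: "continuous_on UNIV (psi s0)"
  using psi_deriv by (auto intro!: DERIV_continuous_on)

text \<open>A product of two weighted bounds carries \<open>g\<^sup>2\<close>; one factor
  \<open>g\<close> is bounded by \<open>\<kappa> + 1\<close>, and the fewer than n summands are
  compensated by the division by n in \<open>low_conv\<close>. Index 0 stays outside because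
  \<open>cc 0 = cos \<psi>\<close> does not decay; the convolutions use only indices from 1 to n -
  1.\<close>

lemma coeff_invariant:
  assumes "n \<ge> 1"
  shows "(\<exists>u'. mode_eq n (low_conv cc n) (uc n) u') \<and> continuous_on UNIV (cc n) \<and> continuous_on UNIV (sc n) \<and>
    (\<forall>s\<ge>0. \<bar>cc n s\<bar> \<le> 2 * amp / 2 ^ n * g s \<and> \<bar>sc n s\<bar> \<le> 2 * amp / 2 ^ n * g s)"
  using assms
proof (induction n rule: less_induct)
  case (less n)
  have cont_u: "continuous_on UNIV (uc k)" if "1 \<le> k" "k < n" for k
    using less(1)[OF that(2,1)] by (auto simp: mode_eq_def intro: DERIV_continuous_on)
  have conv_cont: "continuous_on UNIV (low_conv v n)"
    if "\<And>k. 1 \<le> k \<Longrightarrow> k < n \<Longrightarrow> continuous_on UNIV (v k)" for v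
    unfolding low_conv_def[abs_def] using that cont_u less(2)
    by (auto intro!: continuous_intros)
  have conv_bound: "\<bar>low_conv v n s\<bar> \<le> 2 * amp\<^sup>2 * (\<kappa> + 1) / 2 ^ n * g s"
    if v: "\<And>k. 1 \<le> k \<Longrightarrow> k < n \<Longrightarrow> \<bar>v k s\<bar> \<le> 2 * amp / 2 ^ k * g s" and s: "s \<ge> 0" for v s
  proof -
    have "\<bar>real k * uc k s * v (n - k) s\<bar> \<le> 2 * amp\<^sup>2 * (\<kappa> + 1) / 2 ^ n * g s" if k: "k \<in> {1..<n}" for k
    proof -
      have "\<bar>uc k s\<bar> \<le> amp / (real k * 2 ^ k) * g s"
        using less(1)[of k] k s by (auto simp: mode_eq_def)
      then have "\<bar>real k * uc k s\<bar> \<le> amp / 2 ^ k * g s"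
        using k by (simp add: abs_mult field_simps)
      then have "\<bar>real k * uc k s\<bar> * \<bar>v (n - k) s\<bar> \<le> (amp / 2 ^ k * g s) * (2 * amp / 2 ^ (n - k) * g s)"
        using k v[of "n - k"] amp_pos g_pos[of s] by (intro mult_mono) auto
      also have "\<dots> = 2 * amp\<^sup>2 / (2 ^ k * 2 ^ (n - k)) * g s * g s"
        by (simp add: power2_eq_square)
      also have "(2::real) ^ k * 2 ^ (n - k) = 2 ^ n"
        using k by (simp flip: power_add)
      also have "2 * amp\<^sup>2 / 2 ^ n * g s * g s \<le> 2 * amp\<^sup>2 / 2 ^ n * g s * (\<kappa> + 1)"
        using g_le(2)[OF s] g_pos[of s] by (intro mult_left_mono) auto
      finally show ?thesis by (simp add: abs_mult mult_ac)
    qed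
    then have "\<bar>\<Sum>k\<in>{1..<n}. real k * uc k s * v (n - k) s\<bar> \<le> real (card {1..<n}) * (2 * amp\<^sup>2 * (\<kappa> + 1) / 2 ^ n * g s)"
      by (intro order_trans[OF sum_abs] sum_bounded_above) auto
    also have "\<dots> \<le> real n * (2 * amp\<^sup>2 * (\<kappa> + 1) / 2 ^ n * g s)"
      using g_pos[of s] kappa by (intro mult_right_mono) auto
    finally show ?thesis
      using less(2) by (simp add: low_conv_def field_simps)
  qed
  have f_cont: "continuous_on UNIV (low_conv cc n)" and e_cont: "continuous_on UNIV (low_conv sc n)"
    using less(1) by (intro conv_cont; blast)+
  have fb: "\<bar>low_conv cc n s\<bar> \<le> 2 * amp\<^sup>2 * (\<kappa> + 1) / 2 ^ n * g s"
    and eb: "\<bar>low_conv sc n s\<bar> \<le> 2 * amp\<^sup>2 * (\<kappa> + 1) / 2 ^ n * g s" if "s \<ge> 0" for s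
    using less(1) that by (intro conv_bound; blast)+
  have ex: "\<exists>u'. mode_eq n (low_conv cc n) (uc n) u'"
  proof (cases "n = 1")
    case True
    \<comment> \<open>The convolution is empty, \<open>g\<close> solves the homogeneous equation
      because \<open>\<mu>\<^sup>2 = \<kappa>\<^sup>2 - 1\<close>, and \<open>amp / 2\<close> meets
      the bound for n = 1 with equality.\<close>
    have "mode_eq 1 (low_conv cc 1) (uc 1) (\<lambda>s. amp / 2 * g1 s)"
      using amp_pos g_pos less_imp_le[OF g_pos]
      by (auto simp: mode_eq_def uc_1 low_conv_def mu_sq abs_mult intro!: derivative_eq_intros jost_deriv jost1_deriv)
    then show ?thesis using True by blast
  next
    case False
    then have n: "n \<ge> 2" using less(2) by simp
    show ?thesis
      unfolding uc_some[OF n] by (rule someI_ex[OF mode_eq_solvable[OF n f_cont fb]])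
  qed
  have u_cont: "continuous_on UNIV (uc n)"
    using ex by (auto simp: mode_eq_def intro: DERIV_continuous_on)
  have "continuous_on UNIV (cc n)" "continuous_on UNIV (sc n)"
    unfolding cc_sc[OF less(2), abs_def] by (intro continuous_intros cont_psi f_cont e_cont u_cont)+
  moreover have "\<bar>cc n s\<bar> \<le> 2 * amp / 2 ^ n * g s \<and> \<bar>sc n s\<bar> \<le> 2 * amp / 2 ^ n * g s" if s: "s \<ge> 0" for s
  proof -
    have "amp / (real n * 2 ^ n) \<le> amp / 2 ^ n"
      using less(2) amp_pos by (simp add: field_simps)
    then have ub: "\<bar>uc n s\<bar> \<le> amp / 2 ^ n * g s"
      using ex s mult_right_mono[of "amp / (real n * 2 ^ n)" "amp / 2 ^ n" "g s"] g_pos[of s]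
      by (fastforce simp: mode_eq_def)
    \<comment> \<open>The choice of \<open>amp\<close> brings the convolution part below
      \<open>amp / 2 ^ n * g s\<close>, so that it and the \<open>uc n\<close> part together fit the
      factor 2 of the invariant.\<close>
    have "(2 * amp * (\<kappa> + 1)) * (amp / 2 ^ n * g s) \<le> 1 * (amp / 2 ^ n * g s)"
      using amp_le(1) amp_pos g_pos[of s] by (intro mult_right_mono) auto
    then have c: "2 * amp\<^sup>2 * (\<kappa> + 1) / 2 ^ n * g s \<le> amp / 2 ^ n * g s"
      by (simp add: power2_eq_square mult_ac)
    have "\<bar>uc n s * sin (psi s0 s)\<bar> \<le> amp / 2 ^ n * g s" "\<bar>uc n s * cos (psi s0 s)\<bar> \<le> amp / 2 ^ n * g s"
      using mult_mono[OF ub abs_sin_le_one[of "psi s0 s"]] mult_mono[OF ub abs_cos_le_one[of "psi s0 s"]]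
        amp_pos g_pos[of s] by (auto simp: abs_mult)
    moreover have "2 * amp / 2 ^ n * g s = 2 * (amp / 2 ^ n * g s)" by simp
    ultimately show ?thesis
      unfolding cc_sc[OF less(2)] using fb[OF s] eb[OF s] c by (intro conjI; linarith)
  qed
  ultimately show ?case using ex by auto
qed

end

section \<open>The mode series\<close>

text \<open>The fourth power collects two powers from the space derivatives and two from the time
  factors of a mode.\<close>

lemma summable_poly_half: "summable (\<lambda>n. (real n + 1) ^ 4 / 2 ^ n)"
proof (rule summable_ratio_test[where c = "9/10" and N = 19])
  fix n :: nat assume n: "n \<ge> 19"
  \<comment> \<open>From n = 19 on, (n + 2) / (n + 1) is at most 21/20, whose fourth power is below
    9/5; halving leaves the ratio 9/10.\<close>
  have "real n + 2 \<le> 21/20 * (real n + 1)" using n by simp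
  then have "(real n + 2) ^ 4 \<le> (21/20 * (real n + 1)) ^ 4"
    by (intro power_mono) auto
  also have "\<dots> \<le> 9/5 * (real n + 1) ^ 4"
    unfolding power_mult_distrib by (intro mult_right_mono) (auto simp: power_divide)
  finally show "norm ((real (Suc n) + 1) ^ 4 / 2 ^ Suc n) \<le> 9/10 * norm ((real n + 1) ^ 4 / 2 ^ n)"
    by (simp add: field_simps)
qed auto

section \<open>Spatial derivatives of the modes, their bounds and time factors\<close>

context kink_mode
begin

text \<open>Every \<open>j \<ge> 2\<close> stands for the second derivative, read off from the mode
  equation as \<open>n\<^sup>2 \<mu>\<^sup>2 u_n + s_n\<close>; at n = 0 this is
  \<open>\<psi>'' = sin \<psi>\<close>.\<close>

definition D :: "nat \<Rightarrow> nat \<Rightarrow> real \<Rightarrow> real" where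
  "D j n = (if j = 0 then uc n else if j = 1 then deriv (uc n)
     else (\<lambda>s. (real n)\<^sup>2 * \<mu>\<^sup>2 * uc n s + sc n s))"

lemma uc_mode:
  assumes "n \<ge> 1"
  shows "mode_eq n (low_conv cc n) (uc n) (deriv (uc n))"
proof -
  obtain u' where u': "mode_eq n (low_conv cc n) (uc n) u'"
    using coeff_invariant[OF assms] by blast
  then have "deriv (uc n) = u'"
    by (auto simp: mode_eq_def intro: DERIV_imp_deriv)
  with u' show ?thesis by simp
qed

lemma deriv_uc_0: "deriv (uc 0) = psi1 s0"
  using psi_deriv by (auto simp: coeff_0 intro: DERIV_imp_deriv)

lemma D_deriv:
  assumes "j < 2"
  shows "(D j n has_real_derivative D (Suc j) n s) (at s)"
proof (cases "n = 0")
  case True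
  show ?thesis
    using assms by (auto simp: D_def True deriv_uc_0 less_2_cases_iff coeff_0(3) psi1_deriv)
      (auto simp: coeff_0 psi_deriv)
next
  case False
  then have "mode_eq n (low_conv cc n) (uc n) (deriv (uc n))"
    by (intro uc_mode) simp
  moreover have "(real n)\<^sup>2 * \<mu>\<^sup>2 * uc n s + sc n s = (cos (psi s0 s) + (real n)\<^sup>2 * \<mu>\<^sup>2) * uc n s + low_conv cc n s"
    using False by (simp add: cc_sc algebra_simps)
  ultimately show ?thesis
    using assms by (auto simp: D_def mode_eq_def less_2_cases_iff)
qed

lemma sc_cont: "continuous_on UNIV (sc n)"
proof (cases "n = 0")
  case True
  have "sc 0 = (\<lambda>s. sin (psi s0 s))" by (auto simp: coeff_0)
  then show ?thesis using True by (auto intro!: continuous_intros cont_psi)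
qed (use coeff_invariant[of n] in auto)

lemma D_cont: "continuous_on UNIV (D j n)"
proof -
  have "continuous_on UNIV (D i n)" if "i < 2" for i
    using D_deriv[OF that] by (auto intro!: DERIV_continuous_on)
  from this[of 0] this[of 1] show ?thesis
    unfolding D_def by (auto intro!: continuous_intros sc_cont)
qed

text \<open>The summands account for the kink, for the sine coefficients and for
  \<open>n\<^sup>2 \<mu>\<^sup>2 u_n\<close>, in this order.\<close>

definition Kc :: real where "Kc = 4 * exp s0 + 2 * amp * (\<kappa> + 1) + \<mu>\<^sup>2 * amp * (\<kappa> + 1)"

text \<open>The weight \<open>g\<close> is exchanged for \<open>exp (- s)\<close>, because the kink
  itself decays only at that rate, slower than \<open>g\<close>.\<close>

lemma coeff_bounds:
  assumes s: "s \<ge> 0"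
  shows "\<bar>uc n s\<bar> \<le> Kc / 2 ^ n * exp (- s)" "\<bar>sc n s\<bar> \<le> Kc / 2 ^ n * exp (- s)"
    "\<bar>(real n)\<^sup>2 * \<mu>\<^sup>2 * uc n s + sc n s\<bar> \<le> Kc * (real n + 1)\<^sup>2 / 2 ^ n * exp (- s)"
proof -
  have pos: "0 \<le> amp * (\<kappa> + 1)" "0 \<le> \<mu>\<^sup>2 * amp * (\<kappa> + 1)" "0 \<le> exp s0"
    using amp_pos kappa by auto
  have "\<bar>uc n s\<bar> \<le> Kc / 2 ^ n * exp (- s) \<and> \<bar>sc n s\<bar> \<le> Kc / 2 ^ n * exp (- s) \<and>
    \<bar>(real n)\<^sup>2 * \<mu>\<^sup>2 * uc n s + sc n s\<bar> \<le> Kc * (real n + 1)\<^sup>2 / 2 ^ n * exp (- s)"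
  proof (cases "n = 0")
    case True
    have "4 * exp s0 * exp (- s) \<le> Kc * exp (- s)"
      using pos unfolding Kc_def by (intro mult_right_mono) auto
    moreover have "\<bar>psi s0 s\<bar> \<le> 4 * exp s0 * exp (- s)"
      using psi_bounds[of s0 s] by simp
    moreover have "\<bar>sin (psi s0 s)\<bar> \<le> \<bar>psi s0 s\<bar>"
      by (rule abs_sin_x_le_abs_x)
    ultimately have "\<bar>psi s0 s\<bar> \<le> Kc * exp (- s) \<and> \<bar>sin (psi s0 s)\<bar> \<le> Kc * exp (- s)"
      by linarith
    then show ?thesis
      by (simp add: True coeff_0)
  next
    case False
    then have n: "n \<ge> 1" by simp
    have "amp / (real n * 2 ^ n) \<le> amp / 2 ^ n"
      using n amp_pos by (simp add: field_simps)
    then have "amp / (real n * 2 ^ n) * g s \<le> amp / 2 ^ n * ((\<kappa> + 1) * exp (- s))"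
      using g_le(1)[OF s] g_pos[of s] amp_pos by (intro mult_mono) auto
    then have u: "\<bar>uc n s\<bar> \<le> amp * (\<kappa> + 1) / 2 ^ n * exp (- s)"
      using uc_mode[OF n] s by (fastforce simp: mode_eq_def)
    have "2 * amp / 2 ^ n * g s \<le> 2 * amp / 2 ^ n * ((\<kappa> + 1) * exp (- s))"
      using g_le(1)[OF s] amp_pos by (intro mult_left_mono) auto
    then have sb: "\<bar>sc n s\<bar> \<le> 2 * amp * (\<kappa> + 1) / 2 ^ n * exp (- s)"
      using coeff_invariant[OF n] s by fastforce
    have e: "amp * (\<kappa> + 1) / 2 ^ n * exp (- s) \<le> Kc / 2 ^ n * exp (- s)"
      "2 * amp * (\<kappa> + 1) / 2 ^ n * exp (- s) \<le> Kc / 2 ^ n * exp (- s)"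
      using pos unfolding Kc_def by (intro mult_right_mono divide_right_mono; simp)+
    have n1: "(real n)\<^sup>2 \<le> (real n + 1)\<^sup>2" "1 \<le> (real n + 1)\<^sup>2"
      by (auto intro!: power_mono one_le_power)
    have "\<bar>(real n)\<^sup>2 * \<mu>\<^sup>2 * uc n s\<bar> \<le> (real n + 1)\<^sup>2 * \<mu>\<^sup>2 * (amp * (\<kappa> + 1) / 2 ^ n * exp (- s))"
      unfolding abs_mult using u n1 by (intro mult_mono) auto
    moreover have "\<bar>sc n s\<bar> \<le> (real n + 1)\<^sup>2 * (2 * amp * (\<kappa> + 1) / 2 ^ n * exp (- s))"
      using mult_mono[OF n1(2) sb] pos by (auto simp: mult.assoc)
    ultimately have "\<bar>(real n)\<^sup>2 * \<mu>\<^sup>2 * uc n s + sc n s\<bar>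
       \<le> (2 * amp * (\<kappa> + 1) + \<mu>\<^sup>2 * amp * (\<kappa> + 1)) * (real n + 1)\<^sup>2 / 2 ^ n * exp (- s)"
      by (intro order_trans[OF abs_triangle_ineq]) (simp add: field_simps)
    also have "\<dots> \<le> Kc * (real n + 1)\<^sup>2 / 2 ^ n * exp (- s)"
      using pos unfolding Kc_def by (intro mult_right_mono divide_right_mono) auto
    finally show ?thesis using u sb e by linarith
  qed
  then show "\<bar>uc n s\<bar> \<le> Kc / 2 ^ n * exp (- s)" "\<bar>sc n s\<bar> \<le> Kc / 2 ^ n * exp (- s)"
    "\<bar>(real n)\<^sup>2 * \<mu>\<^sup>2 * uc n s + sc n s\<bar> \<le> Kc * (real n + 1)\<^sup>2 / 2 ^ n * exp (- s)" by auto
qed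

lemma Kc_pos: "Kc > 0"
  using amp_pos kappa by (auto simp: Kc_def intro!: add_pos_nonneg)

lemma cc_bound:
  assumes s: "s \<ge> 0"
  shows "\<bar>cc n s\<bar> \<le> (1 + Kc) / 2 ^ n"
proof (cases "n = 0")
  case True
  then show ?thesis
    using abs_cos_le_one[of "psi s0 s"] Kc_pos by (simp add: coeff_0 del: abs_cos_le_one)
next
  case False
  have "2 * amp / 2 ^ n * g s \<le> 2 * amp / 2 ^ n * (\<kappa> + 1)"
    using g_le(2)[OF s] amp_pos by (intro mult_left_mono) auto
  also have "\<dots> = 2 * amp * (\<kappa> + 1) / 2 ^ n" by simp
  also have "\<dots> \<le> (1 + Kc) / 2 ^ n"
    using amp_le(1) Kc_pos by (intro divide_right_mono) auto
  finally show ?thesis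
    using coeff_invariant[of n] False s by fastforce
qed

text \<open>The recursion controls a mode and its second derivative; the first derivative is
  interpolated between them, hence the factor 3.\<close>

lemma D_bound:
  assumes s: "s \<ge> 0"
  shows "\<bar>D j n s\<bar> \<le> 3 * Kc * (real n + 1)\<^sup>2 / 2 ^ n * exp (- s)"
proof -
  define B where "B = Kc * (real n + 1)\<^sup>2 / 2 ^ n"
  have B: "0 \<le> B" using Kc_pos by (simp add: B_def)
  have "Kc / 2 ^ n \<le> B"
    using Kc_pos unfolding B_def by (intro divide_right_mono) (auto intro!: one_le_power)
  then have u: "\<bar>D 0 n s\<bar> \<le> B * exp (- s)" if "s \<ge> 0" for s
    using coeff_bounds(1)[OF that, of n] mult_right_mono[of "Kc / 2 ^ n" B "exp (- s)"] by (simp add: D_def)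
  have u2: "\<bar>D 2 n s\<bar> \<le> B * exp (- s)" if "s \<ge> 0" for s
    using coeff_bounds(3)[OF that, of n] by (simp add: D_def B_def)
  have "(D 0 n has_real_derivative D 1 n x) (at x)" "(D 1 n has_real_derivative D 2 n x) (at x)" for x
    using D_deriv[of 0] D_deriv[of 1] by (simp_all add: numeral_2_eq_2)
  then have u1: "\<bar>D 1 n s\<bar> \<le> 3 * B * exp (- s)"
    by (rule interpolation_exp_bound) (use u u2 s in auto)
  have "B * exp (- s) \<le> 3 * B * exp (- s)"
    using B by (intro mult_right_mono) auto
  moreover have "D j n = D 0 n \<or> D j n = D 1 n \<or> D j n = D 2 n"
    by (simp add: D_def)
  ultimately have "\<bar>D j n s\<bar> \<le> 3 * B * exp (- s)"
    using u[OF s] u1 u2[OF s] by auto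
  then show ?thesis by (simp add: B_def mult.assoc)
qed

lemma D_robin: "n \<ge> 1 \<Longrightarrow> D 1 n 0 * g 0 = D 0 n 0 * g1 0"
  using uc_mode[of n] by (simp add: D_def mode_eq_def)

text \<open>At fixed s, splitting the term k = n off the full convolutions turns the formulas for
  \<open>cc\<close> and \<open>sc\<close> into the recursions of
  \<open>sin_cos_power_series\<close>.\<close>

lemma sin_series:
  assumes s: "s \<ge> 0" and z: "0 \<le> z" "z \<le> 1"
  shows "(\<Sum>n. sc n s * z ^ n) = sin (\<Sum>n. uc n s * z ^ n)"
proof (rule sin_cos_power_series[where K = "1 + Kc" and C = "\<lambda>n. cc n s"])
  have e: "Kc / 2 ^ n * exp (- s) \<le> (1 + Kc) / 2 ^ n" for n
  proof -
    have "Kc / 2 ^ n * exp (- s) \<le> Kc / 2 ^ n * 1"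
      using Kc_pos s by (intro mult_left_mono) auto
    also have "\<dots> \<le> (1 + Kc) / 2 ^ n"
      by (simp add: divide_right_mono)
    finally show ?thesis .
  qed
  show "\<bar>uc n s\<bar> \<le> (1 + Kc) / 2 ^ n" "\<bar>sc n s\<bar> \<le> (1 + Kc) / 2 ^ n" for n
    using coeff_bounds(1,2)[OF s, of n] e[of n] by linarith+
  show "\<bar>cc n s\<bar> \<le> (1 + Kc) / 2 ^ n" for n
    by (rule cc_bound[OF s])
  have split: "(\<Sum>k=1..n. real k * uc k s * v (n - k) s) = real n * (uc n s * v 0 s + low_conv v n s)"
    if "n \<ge> 1" for n v
  proof -
    have "{1..n} = insert n {1..<n}" using that by auto
    then show ?thesis using that by (simp add: low_conv_def algebra_simps)
  qed
  show "real n * sc n s = (\<Sum>k=1..n. real k * uc k s * cc (n - k) s)" for n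
    using split[of n cc] by (cases "n = 0") (auto simp: cc_sc coeff_0)
  show "real n * cc n s = - (\<Sum>k=1..n. real k * uc k s * sc (n - k) s)" for n
    using split[of n sc] by (cases "n = 0") (auto simp: cc_sc coeff_0 algebra_simps)
qed (use z in \<open>auto simp: coeff_0\<close>)

text \<open>The first mode is \<open>amp / 2 * g\<close>, and all later ones add up to at most
  \<open>amp / 4 * g\<close> in absolute value.\<close>

lemma perturbation_pos:
  assumes s: "s \<ge> 0" and sm: "summable (\<lambda>n. uc (Suc n) s)"
  shows "0 < (\<Sum>n. uc (Suc n) s)"
proof -
  \<comment> \<open>Index 0 of \<open>b\<close> is the first mode itself; from index 1 on it is
    minus the bound of \<open>mode_eq\<close> with 1/n replaced by 1/2, which makes the sum
    explicit.\<close>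
  define b where "b = (\<lambda>n. (amp / 4 * g s) * (3 * (if n = 0 then 1 else 0) - (1/2) ^ n))"
  have "(\<lambda>n. (1/2::real) ^ n) sums 2"
    using geometric_sums[of "1/2::real"] by simp
  moreover have "(\<lambda>n. if n = 0 then 1 else 0 :: real) sums 1"
    using sums_single[of 0 "\<lambda>_. 1::real"] by simp
  ultimately have b: "b sums ((amp / 4 * g s) * (3 * 1 - 2))"
    unfolding b_def by (intro sums_mult sums_diff)
  have "b n \<le> uc (Suc n) s" for n
  proof (cases "n = 0")
    case True
    then show ?thesis by (simp add: b_def uc_1)
  next
    case False
    have "\<bar>uc (Suc n) s\<bar> \<le> amp / (real (Suc n) * 2 ^ Suc n) * g s"
      using uc_mode[of "Suc n"] s unfolding mode_eq_def by auto
    also have "\<dots> \<le> amp / (2 * 2 ^ Suc n) * g s"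
      using False amp_pos g_pos[of s] by (intro mult_right_mono divide_left_mono) auto
    also have "\<dots> = - b n"
      using False by (simp add: b_def power_divide)
    finally show ?thesis by simp
  qed
  then have "suminf b \<le> (\<Sum>n. uc (Suc n) s)"
    by (intro suminf_le sums_summable[OF b] sm)
  moreover have "suminf b = amp / 4 * g s"
    using sums_unique[OF b] by simp
  moreover have "amp / 4 * g s > 0"
    using amp_pos g_pos[of s] by simp
  ultimately show ?thesis by linarith
qed

text \<open>\<open>\<theta> i\<close> is the time dependence of the modes for the time primitive (\<open>i = 0\<close>), the solution (\<open>i = 1\<close>) and its
  first two time derivatives (\<open>i = 2, 3\<close>); likewise \<open>D j\<close> above counts spatial derivatives.\<close>

definition \<theta> :: "nat \<Rightarrow> nat \<Rightarrow> real \<Rightarrow> real" where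
  "\<theta> i n \<tau> = (if n = 0 then (if i = 0 then \<tau> else if i = 1 then 1 else 0)
     else exp (real n * \<mu> * \<tau>) * (real n * \<mu>) ^ i / (real n * \<mu>))"

lemma theta_deriv: "(\<theta> i n has_real_derivative \<theta> (Suc i) n \<tau>) (at \<tau>)"
proof (cases "n = 0")
  case True
  then show ?thesis
    unfolding \<theta>_def by (cases i) (auto intro!: derivative_eq_intros)
next
  case False
  then show ?thesis
    unfolding \<theta>_def using mu_pos by (auto intro!: derivative_eq_intros simp: field_simps)
qed

definition Kt :: real where "Kt = 1 / \<mu> + 1 + \<mu> + \<mu>\<^sup>2"

text \<open>The factor \<open>exp (\<mu> * \<tau>)\<close> is kept because it gives the rate of
  approach to the kink as time tends to minus infinity.\<close>

lemma theta_bound_pos: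
  assumes "n \<ge> 1" "i \<le> 3" "\<tau> \<le> 0"
  shows "\<bar>\<theta> i n \<tau>\<bar> \<le> exp (\<mu> * \<tau>) * (Kt * (real n + 1)\<^sup>2)"
proof -
  have "real n * (- (\<mu> * \<tau>)) \<ge> 1 * (- (\<mu> * \<tau>))"
    using assms mu_pos by (intro mult_right_mono) (auto simp: mult_nonneg_nonpos)
  then have e: "exp (real n * \<mu> * \<tau>) \<le> exp (\<mu> * \<tau>)"
    by (simp add: mult.assoc)
  have n1: "1 \<le> (real n + 1)\<^sup>2" "real n \<le> (real n + 1)\<^sup>2" "(real n)\<^sup>2 \<le> (real n + 1)\<^sup>2"
    by (auto simp: power2_eq_square algebra_simps)
  have K: "1 / \<mu> \<le> Kt" "1 \<le> Kt" "\<mu> \<le> Kt" "\<mu>\<^sup>2 \<le> Kt"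
    using mu_pos by (auto simp: Kt_def)
  have Kpos: "0 \<le> Kt" using K by linarith
  have "i = 0 \<or> i = 1 \<or> i = 2 \<or> i = 3" using assms by auto
  then have "(real n * \<mu>) ^ i / (real n * \<mu>) \<le> Kt * (real n + 1)\<^sup>2"
  proof (elim disjE)
    assume "i = 0"
    moreover have "1 / (real n * \<mu>) \<le> 1 / \<mu>"
      using assms mu_pos by (simp add: field_simps)
    moreover have "1 / \<mu> * 1 \<le> Kt * (real n + 1)\<^sup>2"
      using K n1 Kpos by (intro mult_mono) auto
    ultimately show ?thesis by simp
  next
    assume "i = 1"
    moreover have "1 * 1 \<le> Kt * (real n + 1)\<^sup>2"
      using K n1 Kpos by (intro mult_mono) auto
    ultimately show ?thesis using assms mu_pos by simp
  next
    assume "i = 2"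
    moreover have "\<mu> * real n \<le> Kt * (real n + 1)\<^sup>2"
      using K n1 Kpos by (intro mult_mono) auto
    ultimately show ?thesis using assms mu_pos by (simp add: power2_eq_square mult_ac)
  next
    assume "i = 3"
    moreover have "\<mu>\<^sup>2 * (real n)\<^sup>2 \<le> Kt * (real n + 1)\<^sup>2"
      using K n1 Kpos by (intro mult_mono) auto
    ultimately show ?thesis using assms mu_pos by (simp add: power3_eq_cube power2_eq_square mult_ac)
  qed
  then have "exp (real n * \<mu> * \<tau>) * ((real n * \<mu>) ^ i / (real n * \<mu>)) \<le> exp (\<mu> * \<tau>) * (Kt * (real n + 1)\<^sup>2)"
    using e mu_pos by (intro mult_mono) auto
  then show ?thesis
    using assms mu_pos by (simp add: \<theta>_def abs_mult)
qed

lemma Kt_ge: "1 \<le> Kt"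
  using mu_pos by (auto simp: Kt_def)

text \<open>\<open>1 + T\<close> is due to mode 0 of the primitive, which is \<open>\<tau>\<close>
  itself; the remaining time factors are bounded uniformly in \<open>T\<close>.\<close>

lemma theta_bound:
  assumes "i \<le> 3" "\<tau> \<in> {-T..0}"
  shows "\<bar>\<theta> i n \<tau>\<bar> \<le> (1 + T) * (Kt * (real n + 1)\<^sup>2)"
proof -
  have T: "T \<ge> 0" using assms by auto
  have n1: "1 \<le> Kt * (real n + 1)\<^sup>2"
    using mult_mono[OF Kt_ge, of 1 "(real n + 1)\<^sup>2"] Kt_ge by (auto intro!: one_le_power)
  show ?thesis
  proof (cases "n = 0")
    case True
    have "\<bar>\<theta> i n \<tau>\<bar> \<le> (1 + T) * 1" using True assms by (auto simp: \<theta>_def)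
    also have "\<dots> \<le> (1 + T) * (Kt * (real n + 1)\<^sup>2)"
      using T n1 by (intro mult_left_mono) auto
    finally show ?thesis .
  next
    case False
    have "exp (\<mu> * \<tau>) \<le> 1" using assms mu_pos by (auto simp: mult_nonneg_nonpos)
    then have "exp (\<mu> * \<tau>) \<le> 1 + T" using T by linarith
    then have "exp (\<mu> * \<tau>) * (Kt * (real n + 1)\<^sup>2) \<le> (1 + T) * (Kt * (real n + 1)\<^sup>2)"
      using T n1 by (intro mult_right_mono) auto
    then show ?thesis
      using theta_bound_pos[of n i \<tau>] False assms by auto
  qed
qed

text \<open>\<open>F 1 0\<close> is the solution, \<open>F 2 0\<close> its velocity and
  \<open>F 0 0\<close> a time primitive of the solution.\<close>

definition F :: "nat \<Rightarrow> nat \<Rightarrow> real \<Rightarrow> real \<Rightarrow> real" where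
  "F i j \<tau> s = (\<Sum>n. D j n s * \<theta> i n \<tau>)"

definition KF :: real where "KF = 3 * Kc * Kt"
definition MF :: real where "MF = (\<Sum>n. (real n + 1) ^ 4 / 2 ^ n)"

lemma KF_pos: "KF > 0"
  using Kc_pos Kt_ge by (simp add: KF_def)

lemma MF_nonneg: "MF \<ge> 0"
  unfolding MF_def by (intro suminf_nonneg summable_poly_half) auto

lemma term_bound:
  assumes "s \<ge> 0" "\<bar>\<theta> i n \<tau>\<bar> \<le> A * (Kt * (real n + 1)\<^sup>2)"
  shows "\<bar>D j n s * \<theta> i n \<tau>\<bar> \<le> (A * KF * exp (- s)) * ((real n + 1) ^ 4 / 2 ^ n)"
proof -
  have "\<bar>D j n s\<bar> * \<bar>\<theta> i n \<tau>\<bar> \<le> (3 * Kc * (real n + 1)\<^sup>2 / 2 ^ n * exp (- s)) * (A * (Kt * (real n + 1)\<^sup>2))"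
    using D_bound[OF assms(1), of j n] assms(2) Kc_pos by (intro mult_mono) auto
  also have "\<dots> = (A * KF * exp (- s)) * ((real n + 1) ^ 4 / 2 ^ n)"
    by (simp add: KF_def power2_eq_square power4_eq_xxxx)
  finally show ?thesis by (simp add: abs_mult)
qed

lemma abs_suminf_le:
  fixes f :: "nat \<Rightarrow> real"
  assumes "\<And>n. \<bar>f n\<bar> \<le> C * h n" "summable h"
  shows "summable f" "\<bar>suminf f\<bar> \<le> C * suminf h"
proof -
  have s: "summable (\<lambda>n. \<bar>f n\<bar>)"
    by (rule summable_comparison_test'[OF summable_mult[OF assms(2), of C]]) (use assms in auto)
  then show "summable f" by (rule summable_rabs_cancel)
  have "\<bar>suminf f\<bar> \<le> (\<Sum>n. \<bar>f n\<bar>)" by (rule summable_rabs[OF s])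
  also have "\<dots> \<le> (\<Sum>n. C * h n)"
    by (intro suminf_le s summable_mult assms)
  also have "\<dots> = C * suminf h" by (rule suminf_mult[OF assms(2)])
  finally show "\<bar>suminf f\<bar> \<le> C * suminf h" .
qed

lemma F_summable_bound:
  assumes "s \<ge> 0" "i \<le> 3" "\<tau> \<in> {-T..0}"
  shows "summable (\<lambda>n. D j n s * \<theta> i n \<tau>)" "\<bar>F i j \<tau> s\<bar> \<le> (1 + T) * KF * MF * exp (- s)"
proof -
  show "summable (\<lambda>n. D j n s * \<theta> i n \<tau>)"
    by (rule abs_suminf_le(1)[OF term_bound[OF assms(1) theta_bound[OF assms(2,3)]] summable_poly_half])
  have *: "\<bar>F i j \<tau> s\<bar> \<le> ((1 + T) * KF * exp (- s)) * MF"
    unfolding F_def MF_def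
    by (rule abs_suminf_le(2)[OF term_bound[OF assms(1) theta_bound[OF assms(2,3)]] summable_poly_half])
  show "\<bar>F i j \<tau> s\<bar> \<le> (1 + T) * KF * MF * exp (- s)"
    using * by (simp add: mult_ac)
qed

text \<open>Once mode 0 is split off, all terms are dominated with the factor
  \<open>exp (\<mu> * \<tau>)\<close>; for \<open>i = 1\<close> and \<open>i = 2\<close> this
  measures how far the solution and its velocity are from the kink.\<close>

lemma F_tail:
  assumes "s \<ge> 0" "i \<le> 3" "\<tau> \<le> 0"
  shows "F i j \<tau> s = D j 0 s * \<theta> i 0 \<tau> + (\<Sum>n. D j (Suc n) s * \<theta> i (Suc n) \<tau>)"
    "\<bar>F i j \<tau> s - D j 0 s * \<theta> i 0 \<tau>\<bar> \<le> exp (\<mu> * \<tau>) * KF * MF * exp (- s)"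
proof -
  have sm: "summable (\<lambda>n. D j n s * \<theta> i n \<tau>)"
    using F_summable_bound(1)[of s i \<tau> "- \<tau>"] assms by auto
  show e: "F i j \<tau> s = D j 0 s * \<theta> i 0 \<tau> + (\<Sum>n. D j (Suc n) s * \<theta> i (Suc n) \<tau>)"
    unfolding F_def using suminf_split_head[OF sm] by simp
  have h: "summable (\<lambda>n. (real (Suc n) + 1) ^ 4 / 2 ^ Suc n)"
    using summable_poly_half by (subst summable_Suc_iff)
  have "\<bar>\<Sum>n. D j (Suc n) s * \<theta> i (Suc n) \<tau>\<bar> \<le> (exp (\<mu> * \<tau>) * KF * exp (- s)) * (\<Sum>n. (real (Suc n) + 1) ^ 4 / 2 ^ Suc n)"
    by (rule abs_suminf_le(2)[OF term_bound[OF assms(1) theta_bound_pos] h]) (use assms in auto)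
  also have "(\<Sum>n. (real (Suc n) + 1) ^ 4 / 2 ^ Suc n) \<le> MF"
    unfolding MF_def using suminf_split_head[OF summable_poly_half] by simp
  finally show "\<bar>F i j \<tau> s - D j 0 s * \<theta> i 0 \<tau>\<bar> \<le> exp (\<mu> * \<tau>) * KF * MF * exp (- s)"
    using KF_pos by (simp add: e mult_ac)
qed

text \<open>Uniformity jointly in time and space lets one Weierstrass test serve the slices in
  \<open>\<tau>\<close> and in \<open>s\<close> on which the series is differentiated.\<close>

lemma F_uniform:
  assumes "i \<le> 3" "T \<ge> 0"
  shows "uniform_limit {(\<tau>, s). \<tau> \<in> {-T..0} \<and> s \<ge> 0} (\<lambda>n (\<tau>, s). \<Sum>k<n. D j k s * \<theta> i k \<tau>)
     (\<lambda>(\<tau>, s). F i j \<tau> s) sequentially"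
proof -
  have "uniform_limit {(\<tau>, s). \<tau> \<in> {-T..0} \<and> s \<ge> 0} (\<lambda>n x. \<Sum>k<n. (case x of (\<tau>, s) \<Rightarrow> D j k s * \<theta> i k \<tau>))
     (\<lambda>x. \<Sum>k. (case x of (\<tau>, s) \<Rightarrow> D j k s * \<theta> i k \<tau>)) sequentially"
  proof (rule Weierstrass_m_test)
    show "summable (\<lambda>n. ((1 + T) * KF) * ((real n + 1) ^ 4 / 2 ^ n))"
      by (intro summable_mult summable_poly_half)
    fix n and x :: "real \<times> real" assume x: "x \<in> {(\<tau>, s). \<tau> \<in> {-T..0} \<and> s \<ge> 0}"
    obtain \<tau> s where [simp]: "x = (\<tau>, s)" by (cases x)
    have "\<bar>D j n s * \<theta> i n \<tau>\<bar> \<le> ((1 + T) * KF * exp (- s)) * ((real n + 1) ^ 4 / 2 ^ n)"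
      using x assms by (intro term_bound theta_bound) auto
    also have "\<dots> \<le> ((1 + T) * KF * 1) * ((real n + 1) ^ 4 / 2 ^ n)"
      using x assms KF_pos by (intro mult_right_mono mult_left_mono) auto
    finally show "norm (case x of (\<tau>, s) \<Rightarrow> D j n s * \<theta> i n \<tau>) \<le> ((1 + T) * KF) * ((real n + 1) ^ 4 / 2 ^ n)"
      by simp
  qed
  then show ?thesis
    by (simp add: F_def case_prod_unfold)
qed

lemma F_time_deriv:
  assumes "i \<le> 2" "s \<ge> 0" "\<tau> \<in> {-T..0}"
  shows "((\<lambda>\<tau>. F i j \<tau> s) has_real_derivative F (Suc i) j \<tau> s) (at \<tau> within {-T..0})"
proof -
  have T: "T \<ge> 0" using assms by auto
  have "\<exists>G. \<forall>\<tau>\<in>{-T..0}. (\<lambda>n. D j n s * \<theta> i n \<tau>) sums G \<tau> \<and>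
      (G has_real_derivative F (Suc i) j \<tau> s) (at \<tau> within {-T..0})"
  proof (rule has_field_derivative_series)
    show "((\<lambda>\<tau>. D j n s * \<theta> i n \<tau>) has_real_derivative D j n s * \<theta> (Suc i) n \<tau>) (at \<tau> within {-T..0})" for n \<tau>
      by (auto intro!: derivative_eq_intros has_field_derivative_at_within[OF theta_deriv])
    show "uniform_limit {-T..0} (\<lambda>n \<tau>. \<Sum>k<n. D j k s * \<theta> (Suc i) k \<tau>) (\<lambda>\<tau>. F (Suc i) j \<tau> s) sequentially"
      using uniform_limit_compose'[OF F_uniform[of "Suc i" T j], of "\<lambda>\<tau>. (\<tau>, s)" "{-T..0}"] assms T
      by (auto simp: case_prod_unfold)
    show "summable (\<lambda>n. D j n s * \<theta> i n 0)" "0 \<in> {-T..0}" "convex {-T..0}"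
      using F_summable_bound(1)[of s i 0 T j] assms T by auto
  qed
  then obtain G where G: "\<And>\<tau>. \<tau> \<in> {-T..0} \<Longrightarrow> (\<lambda>n. D j n s * \<theta> i n \<tau>) sums G \<tau>"
    "\<And>\<tau>. \<tau> \<in> {-T..0} \<Longrightarrow> (G has_real_derivative F (Suc i) j \<tau> s) (at \<tau> within {-T..0})" by blast
  have e: "F i j \<tau> s = G \<tau>" if "\<tau> \<in> {-T..0}" for \<tau>
    unfolding F_def using sums_unique[OF G(1)[OF that]] by simp
  show ?thesis
    by (rule has_field_derivative_transform_within[OF G(2)[OF assms(3)] zero_less_one assms(3)])
      (use e in auto)
qed

lemma F_space_deriv:
  assumes "i \<le> 3" "j < 2" "s \<ge> 0" "\<tau> \<le> 0"
  shows "(F i j \<tau> has_real_derivative F i (Suc j) \<tau> s) (at s within {0..})"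
proof -
  define T where "T = - \<tau>"
  have T: "\<tau> \<in> {-T..0}" "T \<ge> 0" using assms by (auto simp: T_def)
  have "\<exists>G. \<forall>s\<in>{0..}. (\<lambda>n. D j n s * \<theta> i n \<tau>) sums G s \<and>
      (G has_real_derivative F i (Suc j) \<tau> s) (at s within {0..})"
  proof (rule has_field_derivative_series)
    show "((\<lambda>s. D j n s * \<theta> i n \<tau>) has_real_derivative D (Suc j) n s * \<theta> i n \<tau>) (at s within {0..})" for n s
      by (auto intro!: derivative_eq_intros has_field_derivative_at_within[OF D_deriv[OF assms(2)]])
    show "uniform_limit {0..} (\<lambda>n s. \<Sum>k<n. D (Suc j) k s * \<theta> i k \<tau>) (\<lambda>s. F i (Suc j) \<tau> s) sequentially"
      using uniform_limit_compose'[OF F_uniform[of i T "Suc j"], of "\<lambda>s. (\<tau>, s)" "{0..}"] assms T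
      by (auto simp: case_prod_unfold)
    show "summable (\<lambda>n. D j n 0 * \<theta> i n \<tau>)" "0 \<in> {0::real..}" "convex {0::real..}"
      using F_summable_bound(1)[of 0 i \<tau> T j] assms T by auto
  qed
  then obtain G where G: "\<And>s. s \<ge> 0 \<Longrightarrow> (\<lambda>n. D j n s * \<theta> i n \<tau>) sums G s"
    "\<And>s. s \<ge> 0 \<Longrightarrow> (G has_real_derivative F i (Suc j) \<tau> s) (at s within {0..})" by fastforce
  have e: "F i j \<tau> s = G s" if "s \<ge> 0" for s
    unfolding F_def using sums_unique[OF G(1)[OF that]] by simp
  show ?thesis
    by (rule has_field_derivative_transform_within[OF G(2)[OF assms(3)] zero_less_one])
      (use e assms in auto)
qed

lemma F_cont:
  assumes "i \<le> 3" "\<tau> \<le> 0"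
  shows "continuous_on {0..} (F i j \<tau>)"
proof -
  define T where "T = - \<tau>"
  have T: "\<tau> \<in> {-T..0}" "T \<ge> 0" using assms by (auto simp: T_def)
  have u: "uniform_limit {0..} (\<lambda>n s. \<Sum>k<n. D j k s * \<theta> i k \<tau>) (F i j \<tau>) sequentially"
    using uniform_limit_compose'[OF F_uniform[of i T j], of "\<lambda>s. (\<tau>, s)" "{0..}"] assms T
    by (auto simp: case_prod_unfold)
  have "\<forall>\<^sub>F n in sequentially. continuous_on {0..} (\<lambda>s. \<Sum>k<n. D j k s * \<theta> i k \<tau>)"
    by (auto intro!: continuous_intros always_eventually continuous_on_subset[OF D_cont])
  then show ?thesis
    by (rule uniform_limit_theorem[OF _ u sequentially_bot])
qed

text \<open>Two time derivatives multiply mode n by \<open>n\<^sup>2 \<mu>\<^sup>2\<close>, and the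
  second space derivative minus that multiple of the mode is \<open>sc n\<close>. What remains is
  the series of \<open>sin_series\<close> at z = \<open>exp (\<mu> * \<tau>)\<close>.\<close>

lemma F_sine_Gordon:
  assumes "s \<ge> 0" "\<tau> \<le> 0"
  shows "F 3 0 \<tau> s = F 1 2 \<tau> s - sin (F 1 0 \<tau> s)"
proof -
  define z where "z = exp (\<mu> * \<tau>)"
  have z: "0 \<le> z" "z \<le> 1" using assms mu_pos by (auto simp: z_def mult_nonneg_nonpos)
  have th1: "\<theta> 1 n \<tau> = z ^ n" for n
    using mu_pos by (auto simp: \<theta>_def z_def mult_ac simp flip: exp_of_nat_mult)
  have th3: "\<theta> 3 n \<tau> = (real n)\<^sup>2 * \<mu>\<^sup>2 * \<theta> 1 n \<tau>" for n
    using mu_pos by (auto simp: \<theta>_def power2_eq_square power3_eq_cube)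
  have sm: "summable (\<lambda>n. D j n s * \<theta> i n \<tau>)" if "i \<le> 3" for i j
    using F_summable_bound(1)[of s i \<tau> "- \<tau>"] assms that by auto
  have "F 1 2 \<tau> s - F 3 0 \<tau> s = (\<Sum>n. D 2 n s * \<theta> 1 n \<tau> - D 0 n s * \<theta> 3 n \<tau>)"
    unfolding F_def by (intro suminf_diff sm) auto
  also have "\<dots> = (\<Sum>n. sc n s * z ^ n)"
    by (intro suminf_cong) (simp add: th3 th1[unfolded One_nat_def] D_def algebra_simps)
  also have "\<dots> = sin (F 1 0 \<tau> s)"
    unfolding F_def th1 using sin_series[OF assms(1) z] by (simp add: D_def)
  finally show ?thesis by simp
qed

text \<open>Mode 0 satisfies the condition by the first part of \<open>b\<close>, the others because
  \<open>D_robin\<close> gives them the boundary ratio of \<open>g\<close>; being linear, the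
  condition passes to the sum.\<close>

lemma F_robin:
  assumes "i \<le> 3" "\<tau> \<le> 0" and b: "psi s0 0 = \<beta> * psi1 s0 0" "g 0 = \<beta> * g1 0"
  shows "F i 0 \<tau> 0 = \<beta> * F i 1 \<tau> 0"
proof -
  have "D 0 n 0 = \<beta> * D 1 n 0" for n
  proof (cases "n = 0")
    case True
    then show ?thesis using b by (simp add: D_def coeff_0 deriv_uc_0[unfolded coeff_0])
  next
    case False
    then have "D 1 n 0 * (\<beta> * g1 0) = D 0 n 0 * g1 0"
      using D_robin[of n] b by simp
    moreover have "g1 0 \<noteq> 0" using g_pos[of 0] b by auto
    ultimately show ?thesis by (simp add: mult.commute)
  qed
  then show ?thesis
    unfolding F_def using suminf_mult[OF F_summable_bound(1)[of 0 i \<tau> "- \<tau>" 1], of \<beta>] assms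
    by (simp add: mult_ac)
qed

lemma F_final_pos:
  assumes "s \<ge> 0"
  shows "psi s0 s < F 1 0 0 s"
proof -
  have th: "\<theta> 1 n 0 = 1" for n using mu_pos by (simp add: \<theta>_def)
  have "summable (\<lambda>n. uc n s)"
    using F_summable_bound(1)[of s 1 0 0 0] assms by (simp add: th[unfolded One_nat_def] D_def)
  then have "summable (\<lambda>n. uc (Suc n) s)" by (subst summable_Suc_iff)
  from perturbation_pos[OF assms this] show ?thesis
    using F_tail(1)[of s 1 0 0] assms by (simp add: th[unfolded One_nat_def] D_def coeff_0)
qed

end

section \<open>Instability\<close>

text \<open>For y < 1 the bound \<open>arctan y \<le> y\<close> suffices. The expression is the
  numerator of the derivative of \<open>(1 + y\<^sup>2) / y * arctan y\<close> and reappears in the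
  Robin defect at \<open>\<kappa> = 1\<close>.\<close>

lemma arctan_kink_pos:
  fixes y :: real
  assumes "y > 0"
  shows "0 < y + (y\<^sup>2 - 1) * arctan y"
proof (cases "y \<ge> 1")
  case True
  then have "0 \<le> (y\<^sup>2 - 1) * arctan y"
    by (intro mult_nonneg_nonneg) auto
  then show ?thesis using assms by linarith
next
  case False
  then have "(1 - y\<^sup>2) * arctan y \<le> (1 - y\<^sup>2) * y"
    using assms by (intro mult_left_mono arctan_le_self) (auto simp: abs_square_le_1 power_le_one)
  also have "\<dots> < 1 * y"
    using assms by (intro mult_strict_right_mono) auto
  finally show ?thesis by (simp add: algebra_simps)
qed

text \<open>The function \<open>f\<close> increases strictly from its limit 1 at 0+ to infinity, and
  \<open>t = - lam / C\<close> exceeds 1.\<close>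

lemma kink_parameter_ex1:
  fixes C lam :: real
  assumes C: "C > 0" and lam: "lam < - C"
  shows "\<exists>!y. 0 < y \<and> (1 + y\<^sup>2) / y * arctan y * C = - lam"
proof -
  define f :: "real \<Rightarrow> real" where "f = (\<lambda>y. (1 + y\<^sup>2) / y * arctan y)"
  have f': "(f has_real_derivative (y + (y\<^sup>2 - 1) * arctan y) / y\<^sup>2) (at y)" if "y > 0" for y
  proof -
    have "1 + y\<^sup>2 \<noteq> 0" by (metis add_pos_nonneg less_irrefl zero_le_power2 zero_less_one)
    then have e: "(1 + y\<^sup>2) / y * inverse (1 + y\<^sup>2) = 1 / y" by (simp add: field_simps)
    have "(f has_real_derivative ((2 * y * y - (1 + y\<^sup>2)) / (y * y)) * arctan y
        + (1 + y\<^sup>2) / y * inverse (1 + y\<^sup>2)) (at y)"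
    proof -
      have alg: "((2 * y * A + J * N) * y - N * A) / (y * y) = (2 * y * y - N) * A / (y * y) + N * J / y"
        for A J N :: real
        using that by (simp add: field_simps)
      show ?thesis
        unfolding f_def using that by (auto intro!: derivative_eq_intros simp: alg)
    qed
    moreover have "((2 * y * y - (1 + y\<^sup>2)) / (y * y)) * arctan y + 1 / y = (y + (y\<^sup>2 - 1) * arctan y) / y\<^sup>2"
      using that by (simp add: field_simps power2_eq_square)
    ultimately show ?thesis unfolding e by simp
  qed
  have mono: "f a < f b" if "0 < a" "a < b" for a b
  proof (rule DERIV_pos_imp_increasing[OF that(2)])
    fix y assume "a \<le> y" "y \<le> b"
    then show "\<exists>d. (f has_real_derivative d) (at y) \<and> 0 < d"
      using f'[of y] arctan_kink_pos[of y] that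
      by (intro exI[of _ "(y + (y\<^sup>2 - 1) * arctan y) / y\<^sup>2"] conjI) auto
  qed
  define t where "t = - lam / C"
  have t: "t > 1" using C lam by (simp add: t_def field_simps)
  \<comment> \<open>Since \<open>arctan a \<le> a\<close>, the value \<open>f a\<close> is at most
    \<open>1 + a\<^sup>2\<close>; this \<open>a\<close> keeps that below \<open>t\<close>.\<close>
  define a where "a = min 1 (sqrt (t - 1) / 2)"
  have a: "0 < a" "a \<le> 1" using t by (auto simp: a_def)
  have "a\<^sup>2 \<le> (sqrt (t - 1) / 2)\<^sup>2"
    using a by (intro power_mono) (auto simp: a_def)
  also have "\<dots> \<le> t - 1" using t by (simp add: power_divide)
  finally have a2: "1 + a\<^sup>2 \<le> t" by simp
  have "f a \<le> (1 + a\<^sup>2) / a * a"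
    unfolding f_def using a by (intro mult_left_mono arctan_le_self) auto
  then have fa: "f a \<le> t" using a a2 by simp
  \<comment> \<open>For \<open>b \<ge> 1\<close> the arctangent is at least pi / 4 > 1/2 and the
    prefactor at least \<open>b\<close>, so \<open>2 * t\<close> is large enough.\<close>
  define b where "b = 2 * t"
  have b: "b \<ge> 1" using t by (simp add: b_def)
  have "t \<le> b * (1 / 2)" by (simp add: b_def)
  also have "\<dots> \<le> b * (pi / 4)"
    using b pi_gt3 by (intro mult_left_mono) auto
  also have "\<dots> \<le> (1 + b\<^sup>2) / b * arctan b"
  proof (rule mult_mono)
    show "pi / 4 \<le> arctan b" using arctan_monotone'[OF b] by (simp add: arctan_one)
    show "b \<le> (1 + b\<^sup>2) / b" using b by (simp add: field_simps power2_eq_square)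
  qed (use b in auto)
  finally have fb: "t \<le> f b" by (simp add: f_def)
  have "\<exists>y. a \<le> y \<and> y \<le> b \<and> f y = t"
    by (rule IVT) (use fa fb a b in \<open>auto intro!: DERIV_isCont[OF f']\<close>)
  then obtain y where "a \<le> y" and ft: "f y = t" by blast
  then have y: "0 < y" "f y = t" using a by auto
  have iff: "(1 + x\<^sup>2) / x * arctan x * C = - lam \<longleftrightarrow> f x = t" for x
    using C by (simp add: f_def t_def field_simps)
  show ?thesis
    unfolding iff using y mono by (metis less_irrefl neqE)
qed

text \<open>At s = 0 the profile is \<open>4 * arctan y\<close> with slope
  \<open>- 4 * y / (1 + y\<^sup>2)\<close>: the Robin condition is the equation that determines
  \<open>y\<close>.\<close>

lemma kink_robin:
  fixes y C lam :: real
  assumes y: "0 < y" "(1 + y\<^sup>2) / y * arctan y * C = - lam" and C: "C > 0"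
  shows "psi (ln y) 0 = lam / C * psi1 (ln y) 0"
proof -
  have "cosh (- ln y) = (1 + y\<^sup>2) / (2 * y)"
    using y by (simp add: cosh_def exp_minus field_simps power2_eq_square)
  moreover have "lam = - ((1 + y\<^sup>2) / y * arctan y * C)"
    using y by simp
  moreover have "1 + y\<^sup>2 \<noteq> 0"
    by (metis add_pos_nonneg less_irrefl zero_le_power2 zero_less_one)
  ultimately show ?thesis
    using y C by (simp add: psi_def psi1_def)
qed

text \<open>\<open>H\<close> is the Robin defect of \<open>jost\<close> at s = 0. It is positive at
  1 because \<open>H 1 = (1 + t) * (1 + \<beta> * t)\<close>, and negative at 4 because its
  quadratic term has the negative coefficient \<open>\<beta>\<close>; the root in between is the
  required \<open>\<kappa>\<close>.\<close>

lemma robin_eigenvalue: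
  fixes y C lam :: real
  assumes y: "0 < y" "(1 + y\<^sup>2) / y * arctan y * C = - lam" and C: "C > 0" and lam: "lam < - C"
  shows "\<exists>\<kappa>>1. jost (ln y) \<kappa> 0 = lam / C * jost1 (ln y) \<kappa> 0"
proof -
  define \<beta> where "\<beta> = lam / C"
  have beta: "\<beta> < - 1" using C lam by (simp add: \<beta>_def field_simps)
  have b: "\<beta> = - ((1 + y\<^sup>2) / y * arctan y)"
    using y C by (simp add: \<beta>_def field_simps)
  define t where "t = tanh (- ln y)"
  have t: "-1 < t" "t < 1"
    using tanh_real_lt_1[of "- ln y"] tanh_real_gt_neg1[of "- ln y"] by (auto simp: t_def)
  have ty: "t = (1 - y\<^sup>2) / (1 + y\<^sup>2)"
    using y by (simp add: t_def tanh_real_altdef exp_double power_divide flip: ln_realpow)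
  have pos: "1 + y\<^sup>2 > 0" by (simp add: add_pos_nonneg)
  define H where "H = (\<lambda>\<kappa>. (\<kappa> + t) - \<beta> * (1 - t\<^sup>2 - \<kappa> * (\<kappa> + t)))"
  have "(1 + y\<^sup>2) / y * arctan y * ((1 - y\<^sup>2) / (1 + y\<^sup>2)) = arctan y * (1 - y\<^sup>2) / y"
  proof -
    have "N / y * A * (M / N) = A * M / y" if "N \<noteq> 0" for A M N :: real
      using that by simp
    then show ?thesis using pos by (metis less_irrefl)
  qed
  then have "1 + \<beta> * t = 1 - arctan y * (1 - y\<^sup>2) / y"
    by (simp add: b ty)
  also have "\<dots> = (y + (y\<^sup>2 - 1) * arctan y) / y"
    using y by (simp add: field_simps)
  finally have "1 + \<beta> * t = (y + (y\<^sup>2 - 1) * arctan y) / y" .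
  then have "1 + \<beta> * t > 0"
    using arctan_kink_pos[of y] y by simp
  moreover have "H 1 = (1 + t) * (1 + \<beta> * t)"
    by (simp add: H_def algebra_simps power2_eq_square)
  ultimately have H1: "H 1 > 0" using t by simp
  \<comment> \<open>At \<open>\<kappa> = 4\<close> the bracket is at most -11, while
    \<open>\<kappa> + t\<close> is below 5 and \<open>- \<beta>\<close> above 1.\<close>
  have "1 - t\<^sup>2 - 4 * (4 + t) \<le> - 11"
  proof -
    have "1 - t\<^sup>2 - 4 * (4 + t) \<le> 1 - 0 - 4 * (4 + (- 1))"
      using t by (intro diff_mono mult_left_mono) auto
    then show ?thesis by simp
  qed
  then have "(- \<beta>) * (1 - t\<^sup>2 - 4 * (4 + t)) \<le> (- \<beta>) * (- 11)"
    using beta by (intro mult_left_mono) auto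
  then have H4: "H 4 < 0" using t beta by (simp add: H_def)
  have "\<exists>\<kappa>. 1 \<le> \<kappa> \<and> \<kappa> \<le> 4 \<and> H \<kappa> = 0"
    by (rule IVT2) (use H1 H4 in \<open>auto simp: H_def intro!: continuous_intros\<close>)
  then obtain \<kappa> where k: "1 \<le> \<kappa>" "H \<kappa> = 0" by blast
  moreover have "\<kappa> \<noteq> 1" using k H1 by auto
  ultimately show ?thesis
    by (intro exI[of _ \<kappa>]) (auto simp: H_def jost_def jost1_def t_def \<beta>_def)
qed

section \<open>Norm positivity, difference quotients and operations on lifted profiles\<close>

lemma not_AE_nonpos: "\<not> (AE x in lebesgue. \<not> 0 < (x::real))"
proof
  assume "AE x in lebesgue. \<not> 0 < (x::real)"
  then have "AE x in lebesgue. x \<notin> {0<..<1::real}" by eventually_elim auto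
  then have "{0<..<1::real} \<in> null_sets lebesgue"
    by (subst AE_iff_null_sets) auto
  then show False by (simp add: null_sets_def)
qed

lemma L2_nrm_pos:
  fixes f :: "real \<Rightarrow> 'a::{banach,second_countable_topology}"
  assumes "f \<in> L2" "\<And>x. x > 0 \<Longrightarrow> f x \<noteq> 0"
  shows "0 < L2_nrm f"
proof -
  have i: "integrable lebesgue (\<lambda>x. indicat_real {0<..} x *\<^sub>R (norm (f x))\<^sup>2)"
    using assms by (simp add: L2_def set_integrable_def)
  have "(LINT x:{0<..}|lebesgue. (norm (f x))\<^sup>2) \<noteq> 0"
  proof
    assume "(LINT x:{0<..}|lebesgue. (norm (f x))\<^sup>2) = 0"
    then have "AE x in lebesgue. indicat_real {0<..} x *\<^sub>R (norm (f x))\<^sup>2 = 0"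
      using integral_nonneg_eq_0_iff_AE[OF i] by (simp add: set_lebesgue_integral_def)
    then have "AE x in lebesgue. \<not> 0 < (x::real)"
      by eventually_elim (use assms in \<open>auto simp: indicator_def split: if_splits\<close>)
    then show False using not_AE_nonpos by blast
  qed
  moreover have "0 \<le> (LINT x:{0<..}|lebesgue. (norm (f x))\<^sup>2)"
    by (simp add: set_lebesgue_integral_def)
  ultimately show ?thesis by (simp add: L2_nrm_def)
qed

text \<open>Since the shift on each edge is \<open>c j * ln y\<close>, the exponent is
  \<open>ln y - x / c j\<close> and one profile serves all edges.\<close>

lemma phi_kink_lift:
  assumes "\<forall>j. 0 < c j"
  shows "phi_kink c lam = lift c (psi (ln (y_kink c lam)))"
proof (intro ext)
  fix j x
  have "c j \<noteq> 0" using assms by (metis less_irrefl)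
  then show "phi_kink c lam j x = lift c (psi (ln (y_kink c lam))) j x"
    by (simp add: phi_kink_def lift_def psi_def b_kink_def field_simps)
qed

lemma tendsto_0_of_lipschitz:
  fixes h :: "real \<Rightarrow> real"
  assumes "\<And>s. s \<in> S \<Longrightarrow> s \<noteq> t \<Longrightarrow> 0 \<le> h s \<and> h s \<le> K * \<bar>s - t\<bar>"
  shows "(h \<longlongrightarrow> 0) (at t within S)"
proof (rule tendsto_sandwich[of "\<lambda>_. 0" _ _ "\<lambda>s. K * \<bar>s - t\<bar>"])
  have "((\<lambda>s. K * \<bar>s - t\<bar>) \<longlongrightarrow> K * \<bar>t - t\<bar>) (at t within S)"
    by (intro tendsto_intros)
  then show "((\<lambda>s. K * \<bar>s - t\<bar>) \<longlongrightarrow> 0) (at t within S)" by simp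
qed (use assms in \<open>auto simp: eventually_at_filter\<close>)

text \<open>The mean value inequality is applied to \<open>k t - t * k' b\<close> on the interval
  between \<open>a\<close> and \<open>b\<close>, where the derivative of this function is at most
  \<open>L\<close> times the length.\<close>

lemma difference_quotient_bound:
  fixes k k' :: "real \<Rightarrow> real"
  assumes d: "\<And>t. t \<in> {l..r} \<Longrightarrow> (k has_real_derivative k' t) (at t within {l..r})"
    and L: "\<And>a b. a \<in> {l..r} \<Longrightarrow> b \<in> {l..r} \<Longrightarrow> \<bar>k' a - k' b\<bar> \<le> L * \<bar>a - b\<bar>"
    and ab: "a \<in> {l..r}" "b \<in> {l..r}" "a \<noteq> b"
  shows "\<bar>1 / (a - b) * (k a - k b) - k' b\<bar> \<le> L * \<bar>a - b\<bar>"
proof -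
  define S where "S = {min a b..max a b}"
  define f where "f = (\<lambda>t. k t - t * k' b)"
  have S: "S \<subseteq> {l..r}" "a \<in> S" "b \<in> S" "convex S" using ab by (auto simp: S_def)
  have L0: "0 \<le> L"
    using order_trans[OF abs_ge_zero L[OF ab(1,2)]] ab(3) by (simp add: zero_le_mult_iff)
  have df: "(f has_real_derivative k' t - k' b) (at t within S)" if "t \<in> S" for t
  proof -
    have "(k has_real_derivative k' t) (at t within S)"
      by (rule DERIV_subset[OF d S(1)]) (use S that in blast)
    then show ?thesis unfolding f_def by (auto intro!: derivative_eq_intros)
  qed
  have bound: "norm (k' t - k' b) \<le> L * \<bar>a - b\<bar>" if "t \<in> S" for t
  proof -
    have "\<bar>k' t - k' b\<bar> \<le> L * \<bar>t - b\<bar>" by (rule L) (use S that in blast)+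
    also have "\<dots> \<le> L * \<bar>a - b\<bar>"
      using that L0 by (intro mult_left_mono) (auto simp: S_def)
    finally show ?thesis by simp
  qed
  have "norm (f a - f b) \<le> (L * \<bar>a - b\<bar>) * norm (a - b)"
    by (rule field_differentiable_bound[OF S(4) df bound S(2,3)])
  then have "\<bar>(k a - k b) - (a - b) * k' b\<bar> \<le> (L * \<bar>a - b\<bar>) * \<bar>a - b\<bar>"
    by (simp add: f_def algebra_simps)
  then have "\<bar>(k a - k b) - (a - b) * k' b\<bar> / \<bar>a - b\<bar> \<le> L * \<bar>a - b\<bar>"
    using ab by (simp add: divide_le_eq)
  moreover have "1 / (a - b) * (k a - k b) - k' b = ((k a - k b) - (a - b) * k' b) / (a - b)"
    using ab by (simp add: field_simps)
  ultimately show ?thesis by (simp add: abs_divide)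
qed

lemma abs_sin_diff_le: "\<bar>sin x - sin y\<bar> \<le> \<bar>x - y\<bar>" for x y :: real
proof -
  have "norm (sin x - sin y) \<le> 1 * norm (x - y)"
    by (rule field_differentiable_bound[of UNIV sin cos]) (auto intro!: derivative_eq_intros)
  then show ?thesis by simp
qed

lemma X_nrm_nonneg: "0 \<le> X_nrm w"
  by (cases w) (auto simp: X_nrm_def intro!: sum_nonneg)

lemma lift_diff: "lift c k - lift c k' = lift c (\<lambda>s. k s - k' s)"
  by (simp add: lift_def fun_eq_iff)

lemma state_scaleR_lift:
  fixes k m :: "real \<Rightarrow> real"
  shows "state_scaleR r (lift c k, lift c m) = (lift c (\<lambda>s. r * k s), lift c (\<lambda>s. r * m s))"
  by (simp add: state_scaleR_def lift_def)

lemma F_nl_lift: "F_nl (lift c k, lift c m) = (lift c (\<lambda>s. 0), lift c (\<lambda>s. - sin (k s)))"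
  by (simp add: F_nl_def lift_def)

section \<open>The growing mode of the linearization\<close>

context kink_mode
begin

text \<open>The mode is the pair of \<open>g\<close> and \<open>\<mu> g\<close> lifted to the edges:
  the linearized flow maps it to \<open>\<mu> g\<close> and \<open>- L g\<close>, and
  \<open>- L g = \<mu>\<^sup>2 g\<close>.\<close>

lemma g_linearly_unstable:
  assumes c: "\<forall>j. 0 < c j"
    and robin: "g 0 = lam / (\<Sum>j\<in>UNIV. c j) * g1 0" and C: "(\<Sum>j\<in>UNIV. c j) > 0"
  shows "linearly_unstable c lam (lift c (psi s0), 0)"
proof -
  define G where "G = (\<lambda>s. complex_of_real (g s))"
  define G1 where "G1 = (\<lambda>s. complex_of_real (g1 s))"
  define g2 where "g2 = (\<lambda>s. (cos (psi s0 s) + (\<kappa>\<^sup>2 - 1)) * g s)"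
  define G2 where "G2 = (\<lambda>s. complex_of_real (g2 s))"
  \<comment> \<open>The factor \<open>cos \<psi> + \<kappa>\<^sup>2 - 1\<close> is at most
    \<open>\<kappa>\<^sup>2\<close> in absolute value, so \<open>B\<close> serves for
    \<open>g\<close> and \<open>g2\<close>; interpolation then gives \<open>3 * B\<close> for
    \<open>g1\<close>.\<close>
  define B where "B = \<kappa>\<^sup>2 * (\<kappa> + 1)"
  have gd: "(g has_real_derivative g1 s) (at s)" "(g1 has_real_derivative g2 s) (at s)" for s
    using jost_deriv jost1_deriv by (auto simp: g2_def)
  have B0: "0 \<le> B" using kappa by (simp add: B_def)
  have gb: "\<bar>g s\<bar> \<le> B * exp (- s)" "\<bar>g2 s\<bar> \<le> B * exp (- s)" if "s \<ge> 0" for s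
  proof -
    have *: "\<kappa>\<^sup>2 * g s \<le> \<kappa>\<^sup>2 * ((\<kappa> + 1) * exp (- s))"
      using g_le(1)[OF that] by (intro mult_left_mono) auto
    have "1 * g s \<le> \<kappa>\<^sup>2 * g s"
      using kappa_sq g_pos[of s] by (intro mult_right_mono) auto
    moreover have "B * exp (- s) = \<kappa>\<^sup>2 * ((\<kappa> + 1) * exp (- s))" by (simp add: B_def)
    ultimately show "\<bar>g s\<bar> \<le> B * exp (- s)"
      using * g_pos[of s] by linarith
    have "\<bar>cos (psi s0 s) + (\<kappa>\<^sup>2 - 1)\<bar> \<le> \<kappa>\<^sup>2"
      using abs_cos_le_one[of "psi s0 s"] kappa_sq by linarith
    then have "\<bar>g2 s\<bar> \<le> \<kappa>\<^sup>2 * g s"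
      using g_pos[of s] by (simp add: g2_def abs_mult mult_right_mono)
    then show "\<bar>g2 s\<bar> \<le> B * exp (- s)"
      using * by (simp add: B_def mult.assoc)
  qed
  have g1b: "\<bar>g1 s\<bar> \<le> 3 * B * exp (- s)" if "s \<ge> 0" for s
    by (rule interpolation_exp_bound[OF gd gb that])
  have B3: "x \<le> B * exp (- s) \<Longrightarrow> x \<le> 3 * B * exp (- s)" for x s
    using B0 by (rule_tac order_trans) (auto intro!: mult_right_mono)
  have vd: "(G has_vector_derivative G1 s) (at s)" "(G1 has_vector_derivative G2 s) (at s)" for s
    unfolding G_def G1_def G2_def
    by (intro bounded_linear.has_vector_derivative[OF bounded_linear_of_real]
        gd[unfolded has_real_derivative_iff_has_vector_derivative])+
  have cont: "isCont g s" "isCont g1 s" for s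
    using gd DERIV_isCont by blast+
  have contG2: "continuous_on UNIV G2"
    unfolding G2_def g2_def using cont
    by (auto intro!: continuous_intros DERIV_isCont[OF psi_deriv] continuous_at_imp_continuous_on)
  have lim: "(G \<longlongrightarrow> G 0) (at_right 0)" "(G1 \<longlongrightarrow> G1 0) (at_right 0)"
    unfolding G_def G1_def using cont[of 0]
    by (auto intro!: tendsto_of_real simp: isCont_def intro: tendsto_mono[OF at_le])
  have bG: "norm (G s) \<le> 3 * B * exp (- s)" "norm (G1 s) \<le> 3 * B * exp (- s)" "norm (G2 s) \<le> 3 * B * exp (- s)"
    if "s > 0" for s
    using gb[of s] g1b[of s] that B3 by (auto simp: G_def G1_def G2_def)
  define Psi where "Psi = (lift c G, lift c (\<lambda>s. of_real \<mu> * G s))"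
  have "lift c G \<in> Dlam c lam"
  proof (rule lift_Dlam[OF c vd _ bG lim])
    have "complex_of_real ((\<Sum>j\<in>UNIV. c j) * g 0) = complex_of_real (lam * g1 0)"
      using robin C by simp
    then show "(\<Sum>j\<in>UNIV. c j) *\<^sub>R G 0 = lam *\<^sub>R G1 0"
      by (simp add: G_def G1_def scaleR_conv_of_real)
  qed (use contG2 continuous_on_subset in auto)
  moreover have "lift c (\<lambda>s. of_real \<mu> * G s) \<in> H1Y"
  proof (rule lift_H1Y[OF c, where ?k1.0 = "\<lambda>s. of_real \<mu> * G1 s" and K = "\<mu> * (3 * B)"])
    show "continuous_on {0<..} (\<lambda>s. complex_of_real \<mu> * G1 s)"
      unfolding G1_def using cont by (auto intro!: continuous_intros continuous_at_imp_continuous_on)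
  qed (use vd bG mu_pos in \<open>auto intro!: derivative_intros simp: norm_mult mult.assoc\<close>)
  ultimately have "Psi \<in> Dom c lam"
    by (simp add: Psi_def Dom_def)
  moreover have "\<not> state_eq Psi 0"
  proof
    assume "state_eq Psi 0"
    then have "AE x in lebesgue. 0 < x \<longrightarrow> lift c G 1 x = 0"
      by (auto simp: state_eq_def Psi_def elim!: allE[of _ 1])
    then have "AE x in lebesgue. \<not> 0 < (x::real)"
      by eventually_elim (use g_pos in \<open>auto simp: lift_def G_def less_imp_neq[symmetric]\<close>)
    then show False using not_AE_nonpos by blast
  qed
  moreover have "state_eq (J_op (E_op (W_op c (lift c (psi s0))) Psi)) (state_scaleC (of_real \<mu>) Psi)"
  proof -
    have "- W_op c (lift c (psi s0)) (lift c G) j x = of_real \<mu> * (of_real \<mu> * lift c G j x)" if "x > 0" for j x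
    proof -
      have cj: "c j > 0" using c by auto
      have "dx (dx (lift c G j)) x = (1 / (c j)\<^sup>2) *\<^sub>R lift c G2 j x"
        by (rule dx_dx_lift[where k = G and ?k1.0 = G1]) (use cj vd that in auto)
      then have "- W_op c (lift c (psi s0)) (lift c G) j x = lift c G2 j x - cos (lift c (psi s0) j x) *\<^sub>R lift c G j x"
        using cj by (simp add: W_op_def)
      also have "\<dots> = complex_of_real (\<mu>\<^sup>2 * g (x / c j))"
        by (simp add: lift_def G2_def G_def g2_def mu_sq scaleR_conv_of_real algebra_simps)
      finally show ?thesis
        by (simp add: lift_def G_def power2_eq_square)
    qed
    then show ?thesis
      by (auto simp: state_eq_def J_op_def E_op_def Psi_def state_scaleC_def) (simp_all add: lift_def)
  qed
  ultimately show ?thesis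
    unfolding linearly_unstable_def fst_conv
    using mu_pos by (intro exI[of _ "complex_of_real \<mu>"] exI[of _ Psi]) auto
qed


section \<open>The orbit on the unstable manifold as a mild solution\<close>

lemma F_lipschitz:
  assumes "i \<le> 2" "s \<ge> 0" "a \<in> {-T..0}" "b \<in> {-T..0}"
  shows "\<bar>F i j a s - F i j b s\<bar> \<le> (1 + T) * KF * MF * exp (- s) * \<bar>a - b\<bar>"
proof -
  have "norm (F i j a s - F i j b s) \<le> (1 + T) * KF * MF * exp (- s) * norm (a - b)"
  proof (rule field_differentiable_bound[where S = "{-T..0}" and f = "\<lambda>\<tau>. F i j \<tau> s"])
    show "((\<lambda>\<tau>. F i j \<tau> s) has_real_derivative F (Suc i) j \<tau> s) (at \<tau> within {-T..0})" if "\<tau> \<in> {-T..0}" for \<tau>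
      using F_time_deriv assms that by blast
    show "norm (F (Suc i) j \<tau> s) \<le> (1 + T) * KF * MF * exp (- s)" if "\<tau> \<in> {-T..0}" for \<tau>
      using F_summable_bound(2)[of s "Suc i" \<tau> T j] assms that by simp
  qed (use assms in auto)
  then show ?thesis by simp
qed

text \<open>The error is uniform in s against \<open>exp (- s)\<close>, which yields
  differentiability in time in the norm of \<open>X\<close>.\<close>

lemma F_quotient:
  assumes "i \<le> 1" "s \<ge> 0" "a \<in> {-T..0}" "b \<in> {-T..0}" "a \<noteq> b"
  shows "\<bar>1 / (a - b) * (F i j a s - F i j b s) - F (Suc i) j b s\<bar> \<le> (1 + T) * KF * MF * exp (- s) * \<bar>a - b\<bar>"
  by (rule difference_quotient_bound[where l = "-T" and r = 0 and k = "\<lambda>\<tau>. F i j \<tau> s" and k' = "\<lambda>\<tau>. F (Suc i) j \<tau> s"])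
    (use assms in \<open>auto intro!: F_time_deriv F_lipschitz\<close>)

text \<open>By the sine-Gordon equation, \<open>F 2 0 - F 0 2\<close> is a time primitive of minus
  the sine of the solution, so the nonlinear term is integrated in closed form.\<close>

lemma F_nonlinear_quotient:
  assumes "s \<ge> 0" "a \<in> {-T..0}" "b \<in> {-T..0}" "a \<noteq> b"
  shows "\<bar>1 / (a - b) * ((F 2 0 a s - F 0 2 a s) - (F 2 0 b s - F 0 2 b s)) - (- sin (F 1 0 b s))\<bar>
    \<le> (1 + T) * KF * MF * exp (- s) * \<bar>a - b\<bar>"
proof (rule difference_quotient_bound[where l = "-T" and r = 0 and k = "\<lambda>\<tau>. F 2 0 \<tau> s - F 0 2 \<tau> s" and k' = "\<lambda>\<tau>. - sin (F 1 0 \<tau> s)"])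
  show "((\<lambda>\<tau>. F 2 0 \<tau> s - F 0 2 \<tau> s) has_real_derivative - sin (F 1 0 t s)) (at t within {-T..0})"
    if t: "t \<in> {-T..0}" for t
  proof -
    have "((\<lambda>\<tau>. F 2 0 \<tau> s - F 0 2 \<tau> s) has_real_derivative F (Suc 2) 0 t s - F (Suc 0) 2 t s) (at t within {-T..0})"
      using assms t by (intro derivative_intros F_time_deriv) auto
    moreover have "F (Suc 2) 0 t s - F (Suc 0) 2 t s = - sin (F 1 0 t s)"
      using F_sine_Gordon[of s t] assms t by (simp add: numeral_3_eq_3 numeral_2_eq_2)
    ultimately show ?thesis by simp
  qed
  show "\<bar>- sin (F 1 0 a s) - - sin (F 1 0 b s)\<bar> \<le> (1 + T) * KF * MF * exp (- s) * \<bar>a - b\<bar>"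
    if "a \<in> {-T..0}" "b \<in> {-T..0}" for a b
    using order_trans[OF abs_sin_diff_le[of "F 1 0 b s" "F 1 0 a s"] F_lipschitz[of 1 s b T a 0]] that assms
    by (simp add: abs_minus_commute)
qed (use assms in auto)

lemma F_vector_deriv:
  assumes "i \<le> 3" "j < 2" "s > 0" "\<tau> \<le> 0"
  shows "(F i j \<tau> has_vector_derivative F i (Suc j) \<tau> s) (at s)"
proof -
  have "(F i j \<tau> has_real_derivative F i (Suc j) \<tau> s) (at s within {0<..})"
    using F_space_deriv[of i j s \<tau>] assms by (auto intro: DERIV_subset)
  then show ?thesis
    using assms by (simp add: at_within_open[of s "{0<..}"] has_real_derivative_iff_has_vector_derivative)
qed

lemma F_cont_pos:
  assumes "i \<le> 3" "\<tau> \<le> 0"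
  shows "continuous_on {0<..} (F i j \<tau>)"
  using F_cont[OF assms] by (rule continuous_on_subset) auto

lemma F_trace:
  assumes "i \<le> 3" "\<tau> \<le> 0"
  shows "(F i j \<tau> \<longlongrightarrow> F i j \<tau> 0) (at_right 0)"
proof -
  have "(F i j \<tau> \<longlongrightarrow> F i j \<tau> 0) (at 0 within {0..})"
    using F_cont[OF assms, of j] by (auto simp: continuous_on_def)
  then show ?thesis
    by (rule tendsto_within_subset) auto
qed

lemma F_exp_bound:
  assumes "i \<le> 3" "s > 0" "\<tau> \<in> {-T..0}"
  shows "norm (F i j \<tau> s) \<le> (1 + T) * KF * MF * exp (- s)"
  using F_summable_bound(2)[of s i \<tau> T j] assms by simp

lemma F_diff_bound:
  assumes "i \<le> 3" "s > 0" "a \<in> {-T..0}" "b \<in> {-T..0}"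
  shows "norm (F i j a s - F i j b s) \<le> (2 * ((1 + T) * KF * MF)) * exp (- s)"
proof -
  have "norm (F i j a s - F i j b s) \<le> norm (F i j a s) + norm (F i j b s)"
    by (rule norm_triangle_ineq4)
  also have "\<dots> \<le> (1 + T) * KF * MF * exp (- s) + (1 + T) * KF * MF * exp (- s)"
    by (intro add_mono F_exp_bound assms)
  finally show ?thesis by (simp only: mult_2 distrib_right)
qed

definition orbit :: "(3 \<Rightarrow> real) \<Rightarrow> real \<Rightarrow> real state" where
  "orbit c \<tau> = (lift c (F 1 0 \<tau>), lift c (F 2 0 \<tau>))"

text \<open>Time t in [0, T] corresponds to \<open>\<tau> = t - T\<close>. Time primitives of the
  orbit and of its nonlinear term are explicit in \<open>F\<close>, and the mild equation becomes a
  telescoping identity.\<close>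

lemma orbit_solution:
  assumes c: "\<forall>j. 0 < c j" and T: "T \<ge> 0" and lam: "lam = \<beta> * (\<Sum>j\<in>UNIV. c j)"
    and robin: "psi s0 0 = \<beta> * psi1 s0 0" "g 0 = \<beta> * g1 0"
  shows "sG_solution c lam (orbit c (- T)) T (\<lambda>t. orbit c (t - T))"
proof -
  define B where "B = (1 + T) * KF * MF"
  have B: "0 \<le> B" using T KF_pos MF_nonneg by (simp add: B_def)
  have time: "t - T \<in> {-T..0}" if "t \<in> {0..T}" for t using that by auto
  note Fb = F_exp_bound[where T = T, folded B_def]
  note Fdb = F_diff_bound[where T = T, folded B_def]
  note Flip = F_lipschitz[where T = T, folded B_def]
  note Fq = F_quotient[where T = T, folded B_def]
  note Fnq = F_nonlinear_quotient[where T = T, folded B_def]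
  have small: "((\<lambda>s. X_nrm (h s)) \<longlongrightarrow> 0) (at t within {0..T})"
    if "\<And>s. s \<in> {0..T} \<Longrightarrow> s \<noteq> t \<Longrightarrow> X_nrm (h s) \<le> (B * \<bar>s - t\<bar>) * X_exp c" for h :: "real \<Rightarrow> real state" and t
    by (rule tendsto_0_of_lipschitz[where K = "B * X_exp c"]) (use that in \<open>auto simp: mult_ac X_nrm_nonneg\<close>)
  have cont: "X_continuous T (\<lambda>t. orbit c (t - T))"
    unfolding X_continuous_def
  proof (intro ballI conjI)
    fix t assume t: "t \<in> {0..T}"
    show "orbit c (t - T) \<in> X"
      unfolding orbit_def X_def
      using time[OF t] T
      by (auto intro!: lift_H1Y[OF c F_vector_deriv[where j = 0] F_cont_pos Fb Fb] lift_L2Y[OF c F_cont_pos Fb])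
    show "((\<lambda>s. X_nrm (orbit c (s - T) - orbit c (t - T))) \<longlongrightarrow> 0) (at t within {0..T})"
    proof (rule small)
      fix s assume s: "s \<in> {0..T}"
      have b: "norm (F i j (s - T) x - F i j (t - T) x) \<le> B * \<bar>s - t\<bar> * exp (- x)" if "x > 0" "i \<le> 2" for i j x
        using Flip[of i x "s - T" "t - T" j] that time[OF s] time[OF t] by (simp add: mult_ac)
      show "X_nrm (orbit c (s - T) - orbit c (t - T)) \<le> B * \<bar>s - t\<bar> * X_exp c"
        unfolding orbit_def minus_prod_def fst_conv snd_conv lift_diff
      proof (rule X_nrm_lift_le[OF c])
        show "((\<lambda>x. F 1 0 (s - T) x - F 1 0 (t - T) x) has_vector_derivative
            F 1 (Suc 0) (s - T) x - F 1 (Suc 0) (t - T) x) (at x)" if "x > 0" for x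
          using that s t by (intro has_vector_derivative_diff F_vector_deriv) auto
      qed (use b B in auto)
    qed
  qed
  \<comment> \<open>\<open>F 0\<close> is a primitive of \<open>F 1\<close>, and \<open>F 1\<close>
    of \<open>F 2\<close>; the values at \<open>- T\<close> are subtracted so that \<open>W\<close>
    starts at 0.\<close>
  define W where "W = (\<lambda>t. (lift c (\<lambda>s. F 0 0 (t - T) s - F 0 0 (- T) s), lift c (\<lambda>s. F 1 0 (t - T) s - F 1 0 (- T) s)))"
  \<comment> \<open>The primitive from \<open>F_nonlinear_quotient\<close>, normalized to vanish at
    t = 0.\<close>
  define Z where "Z = (\<lambda>t. (lift c (\<lambda>s. 0 :: real),
    lift c (\<lambda>s. (F 2 0 (t - T) s - F 0 2 (t - T) s) - (F 2 0 (- T) s - F 0 2 (- T) s))))"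
  have T0: "- T \<in> {-T..0}" "- T \<le> 0" using T by auto
  have H1: "lift c (\<lambda>s. F i 0 (t - T) s - F i 0 (- T) s) \<in> H1Y" if t: "t \<in> {0..T}" and "i \<le> 3" for i t
  proof (rule lift_H1Y[OF c _ _ Fdb Fdb])
    show "((\<lambda>s. F i 0 (t - T) s - F i 0 (- T) s) has_vector_derivative F i (Suc 0) (t - T) s - F i (Suc 0) (- T) s) (at s)"
      if "s > 0" for s
      using that t \<open>i \<le> 3\<close> T by (intro has_vector_derivative_diff F_vector_deriv) auto
    show "continuous_on {0<..} (\<lambda>s. F i (Suc 0) (t - T) s - F i (Suc 0) (- T) s)"
      using t \<open>i \<le> 3\<close> T by (intro continuous_intros F_cont_pos) auto
  qed (use that T time[OF t] in auto)
  have Dlam: "lift c (\<lambda>s. F 0 0 (t - T) s - F 0 0 (- T) s) \<in> Dlam c lam" if t: "t \<in> {0..T}" for t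
  proof (rule lift_Dlam[OF c, where
        ?k1.0 = "\<lambda>s. F 0 (Suc 0) (t - T) s - F 0 (Suc 0) (- T) s" and
        ?k2.0 = "\<lambda>s. F 0 (Suc (Suc 0)) (t - T) s - F 0 (Suc (Suc 0)) (- T) s" and
        l = "F 0 0 (t - T) 0 - F 0 0 (- T) 0" and ?l1.0 = "F 0 (Suc 0) (t - T) 0 - F 0 (Suc 0) (- T) 0" and K = "2 * B"])
    show "((\<lambda>s. F 0 0 (t - T) s - F 0 0 (- T) s) has_vector_derivative F 0 (Suc 0) (t - T) s - F 0 (Suc 0) (- T) s) (at s)"
      "((\<lambda>s. F 0 (Suc 0) (t - T) s - F 0 (Suc 0) (- T) s) has_vector_derivative
        F 0 (Suc (Suc 0)) (t - T) s - F 0 (Suc (Suc 0)) (- T) s) (at s)" if "s > 0" for s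
      using that t T by (auto intro!: has_vector_derivative_diff F_vector_deriv)
    show "continuous_on {0<..} (\<lambda>s. F 0 (Suc (Suc 0)) (t - T) s - F 0 (Suc (Suc 0)) (- T) s)"
      using t T by (intro continuous_intros F_cont_pos) auto
    show "((\<lambda>s. F 0 0 (t - T) s - F 0 0 (- T) s) \<longlongrightarrow> F 0 0 (t - T) 0 - F 0 0 (- T) 0) (at_right 0)"
      "((\<lambda>s. F 0 (Suc 0) (t - T) s - F 0 (Suc 0) (- T) s) \<longlongrightarrow> F 0 (Suc 0) (t - T) 0 - F 0 (Suc 0) (- T) 0) (at_right 0)"
      using t T by (auto intro!: tendsto_diff F_trace)
    show "(\<Sum>j\<in>UNIV. c j) *\<^sub>R (F 0 0 (t - T) 0 - F 0 0 (- T) 0) = lam *\<^sub>R (F 0 (Suc 0) (t - T) 0 - F 0 (Suc 0) (- T) 0)"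
      using F_robin[OF _ _ robin, of 0 "t - T"] F_robin[OF _ _ robin, of 0 "- T"] t T
      by (simp add: lam algebra_simps)
  qed (use Fdb T0 time[OF t] in auto)
  have curveW: "X_integral_curve T (\<lambda>t. orbit c (t - T)) W"
    unfolding X_integral_curve_def
  proof (intro conjI ballI)
    show "state_eq (W 0) 0"
      by (simp add: state_eq_def W_def lift_def)
    fix t assume t: "t \<in> {0..T}"
    show "W t \<in> X"
      using H1[OF t, of 0] H1[OF t, of 1] by (auto simp: W_def X_def H1Y_def L2Y_def H1_def)
    show "((\<lambda>s. X_nrm (state_scaleR (1 / (s - t)) (W s - W t) - orbit c (t - T))) \<longlongrightarrow> 0) (at t within {0..T})"
    proof (rule small)
      fix s assume s: "s \<in> {0..T}" "s \<noteq> t"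
      have e: "state_scaleR (1 / (s - t)) (W s - W t) - orbit c (t - T) =
        (lift c (\<lambda>x. 1 / (s - t) * (F 0 0 (s - T) x - F 0 0 (t - T) x) - F 1 0 (t - T) x),
         lift c (\<lambda>x. 1 / (s - t) * (F 1 0 (s - T) x - F 1 0 (t - T) x) - F 2 0 (t - T) x))"
        by (simp add: W_def orbit_def lift_diff state_scaleR_lift)
      have b: "norm (1 / (s - t) * (F i j (s - T) x - F i j (t - T) x) - F (Suc i) j (t - T) x) \<le> B * \<bar>s - t\<bar> * exp (- x)"
        if "x > 0" "i \<le> 1" for i j x
        using Fq[of i x "s - T" "t - T" j] that time[OF s(1)] time[OF t] s by (simp add: mult_ac)
      show "X_nrm (state_scaleR (1 / (s - t)) (W s - W t) - orbit c (t - T)) \<le> B * \<bar>s - t\<bar> * X_exp c"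
        unfolding e
      proof (rule X_nrm_lift_le[OF c])
        show "((\<lambda>x. 1 / (s - t) * (F 0 0 (s - T) x - F 0 0 (t - T) x) - F 1 0 (t - T) x) has_vector_derivative
            1 / (s - t) * (F 0 (Suc 0) (s - T) x - F 0 (Suc 0) (t - T) x) - F 1 (Suc 0) (t - T) x) (at x)" if "x > 0" for x
          using that s t
          by (intro has_vector_derivative_diff bounded_linear.has_vector_derivative[OF bounded_linear_mult_right] F_vector_deriv) auto
      qed (use b[of _ 0] b[of _ 1] B in \<open>auto simp: numeral_2_eq_2\<close>)
    qed
  qed
  have curveZ: "X_integral_curve T (\<lambda>t. F_nl (orbit c (t - T))) Z"
    unfolding X_integral_curve_def
  proof (intro conjI ballI)
    show "state_eq (Z 0) 0"
      by (simp add: state_eq_def Z_def lift_def)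
    fix t assume t: "t \<in> {0..T}"
    show "Z t \<in> X"
    proof -
      have "lift c (\<lambda>s. (F 2 0 (t - T) s - F 0 2 (t - T) s) - (F 2 0 (- T) s - F 0 2 (- T) s)) \<in> L2Y"
      proof (rule lift_L2Y[OF c, where K = "4 * B"])
        show "continuous_on {0<..} (\<lambda>s. (F 2 0 (t - T) s - F 0 2 (t - T) s) - (F 2 0 (- T) s - F 0 2 (- T) s))"
          using t T by (intro continuous_intros F_cont_pos) auto
        fix s :: real assume "s > 0"
        then show "norm ((F 2 0 (t - T) s - F 0 2 (t - T) s) - (F 2 0 (- T) s - F 0 2 (- T) s)) \<le> 4 * B * exp (- s)"
          using Fb[of 2 s "t - T" 0] Fb[of 0 s "t - T" 2] Fb[of 2 s "- T" 0] Fb[of 0 s "- T" 2] time[OF t] T0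
          by simp
      qed
      moreover have "lift c (\<lambda>s. 0 :: real) \<in> H1Y"
        by (rule lift_H1Y[OF c, where ?k1.0 = "\<lambda>_. 0" and K = 0]) auto
      ultimately show ?thesis by (simp add: Z_def X_def)
    qed
    show "((\<lambda>s. X_nrm (state_scaleR (1 / (s - t)) (Z s - Z t) - F_nl (orbit c (t - T)))) \<longlongrightarrow> 0) (at t within {0..T})"
    proof (rule small)
      fix s assume s: "s \<in> {0..T}" "s \<noteq> t"
      have e: "state_scaleR (1 / (s - t)) (Z s - Z t) - F_nl (orbit c (t - T)) =
        (lift c (\<lambda>x. 0), lift c (\<lambda>x. 1 / (s - t) * ((F 2 0 (s - T) x - F 0 2 (s - T) x) - (F 2 0 (t - T) x - F 0 2 (t - T) x))
           - (- sin (F 1 0 (t - T) x))))"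
        unfolding Z_def orbit_def minus_prod_def fst_conv snd_conv lift_diff state_scaleR_lift F_nl_lift
        by (simp add: algebra_simps)
      have b: "norm (1 / (s - t) * ((F 2 0 (s - T) x - F 0 2 (s - T) x) - (F 2 0 (t - T) x - F 0 2 (t - T) x))
           - (- sin (F 1 0 (t - T) x))) \<le> B * \<bar>s - t\<bar> * exp (- x)" if "x > 0" for x
        using Fnq[of x "s - T" "t - T"] that time[OF s(1)] time[OF t] s by (simp add: mult_ac)
      show "X_nrm (state_scaleR (1 / (s - t)) (Z s - Z t) - F_nl (orbit c (t - T))) \<le> B * \<bar>s - t\<bar> * X_exp c"
        unfolding e by (rule X_nrm_lift_le[OF c, where ?k1.0 = "\<lambda>_. 0"]) (use b B in auto)
    qed
  qed
  have dom: "W t \<in> Dom c lam" if "t \<in> {0..T}" for t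
    using Dlam[OF that] H1[OF that, of 1] by (simp add: W_def Dom_def)
  have eq: "state_eq (orbit c (t - T)) (orbit c (- T) + J_op (E_op (T_op c) (W t)) + Z t)" if t: "t \<in> {0..T}" for t
  proof -
    have d2: "dx (dx (lift c (\<lambda>s. F 0 0 (t - T) s - F 0 0 (- T) s) j)) x =
       (1 / (c j)\<^sup>2) *\<^sub>R lift c (\<lambda>s. F 0 (Suc (Suc 0)) (t - T) s - F 0 (Suc (Suc 0)) (- T) s) j x" if "x > 0" for j x
    proof (rule dx_dx_lift[where ?k1.0 = "\<lambda>s. F 0 (Suc 0) (t - T) s - F 0 (Suc 0) (- T) s"])
      show "((\<lambda>s. F 0 0 (t - T) s - F 0 0 (- T) s) has_vector_derivative F 0 (Suc 0) (t - T) s - F 0 (Suc 0) (- T) s) (at s)"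
        "((\<lambda>s. F 0 (Suc 0) (t - T) s - F 0 (Suc 0) (- T) s) has_vector_derivative
          F 0 (Suc (Suc 0)) (t - T) s - F 0 (Suc (Suc 0)) (- T) s) (at s)" if "s > 0" for s
        using that t T by (auto intro!: has_vector_derivative_diff F_vector_deriv)
    qed (use c that in auto)
    have "(c j)\<^sup>2 * dx (dx (lift c (\<lambda>s. F 0 0 (t - T) s - F 0 0 (- T) s) j)) x = F 0 2 (t - T) (x / c j) - F 0 2 (- T) (x / c j)"
      if "x > 0" for j x
    proof -
      have "c j \<noteq> 0" using c by (metis less_irrefl)
      then show ?thesis unfolding d2[OF that] by (simp add: lift_def numeral_2_eq_2)
    qed
    then have "snd (orbit c (t - T)) j x = snd (orbit c (- T) + J_op (E_op (T_op c) (W t)) + Z t) j x" if "x > 0" for j x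
      using that by (simp add: orbit_def J_op_def E_op_def T_op_def W_def Z_def) (simp add: lift_def)
    moreover have "fst (orbit c (t - T)) = fst (orbit c (- T) + J_op (E_op (T_op c) (W t)) + Z t)"
      by (simp add: orbit_def J_op_def E_op_def T_op_def W_def Z_def lift_def fun_eq_iff)
    ultimately show ?thesis
      by (auto simp: state_eq_def)
  qed
  show ?thesis
    unfolding sG_solution_def using cont curveW curveZ dom eq by blast
qed

text \<open>One orbit serves every \<open>delta\<close>: started at \<open>\<tau> = - T\<close> with
  \<open>T\<close> large it is within \<open>delta\<close> of the kink, and after time
  \<open>T\<close> it is at \<open>orbit c 0\<close>, whose distance \<open>r\<close> from the kink
  is fixed.\<close>

lemma orbit_nonlinearly_unstable:
  assumes c: "\<forall>j. 0 < c j" and lam: "lam = \<beta> * (\<Sum>j\<in>UNIV. c j)"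
    and robin: "psi s0 0 = \<beta> * psi1 s0 0" "g 0 = \<beta> * g1 0"
  shows "nonlinearly_unstable c lam (lift c (psi s0), 0)"
proof -
  define P :: "real state" where "P = (lift c (psi s0), 0)"
  \<comment> \<open>Writing the zero velocity as a lifted profile makes \<open>lift_diff\<close> and
    \<open>X_nrm_lift_le\<close> applicable.\<close>
  have P: "P = (lift c (psi s0), lift c (\<lambda>_. 0))"
    by (simp add: P_def lift_def zero_fun_def)
  have X: "orbit c \<tau> \<in> X" if "\<tau> \<le> 0" for \<tau>
    using orbit_solution[OF c _ lam robin, of "- \<tau>"] that
    by (auto simp: sG_solution_def X_continuous_def dest: bspec[of _ _ 0])
  have psi_vd: "(psi s0 has_vector_derivative psi1 s0 s) (at s)" for s
    using psi_deriv by (simp add: has_real_derivative_iff_has_vector_derivative)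
  have close: "X_nrm (P - orbit c \<tau>) \<le> exp (\<mu> * \<tau>) * (KF * MF * X_exp c)" if tau: "\<tau> \<le> 0" for \<tau>
  proof -
    have b1: "norm (psi s0 s - F 1 0 \<tau> s) \<le> exp (\<mu> * \<tau>) * KF * MF * exp (- s)"
      "norm (psi1 s0 s - F 1 (Suc 0) \<tau> s) \<le> exp (\<mu> * \<tau>) * KF * MF * exp (- s)"
      "norm (0 - F 2 0 \<tau> s) \<le> exp (\<mu> * \<tau>) * KF * MF * exp (- s)" if "s > 0" for s
      using F_tail(2)[of s 1 \<tau> 0] F_tail(2)[of s 1 \<tau> "Suc 0"] F_tail(2)[of s 2 \<tau> 0] that tau
      by (auto simp: D_def \<theta>_def coeff_0 deriv_uc_0[unfolded coeff_0] abs_minus_commute)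
    have "X_nrm (P - orbit c \<tau>) \<le> (exp (\<mu> * \<tau>) * KF * MF) * X_exp c"
      unfolding P orbit_def minus_prod_def fst_conv snd_conv lift_diff
    proof (rule X_nrm_lift_le[OF c _ _ b1])
      show "((\<lambda>s. psi s0 s - F 1 0 \<tau> s) has_vector_derivative psi1 s0 s - F 1 (Suc 0) \<tau> s) (at s)" if "s > 0" for s
        using that tau by (intro has_vector_derivative_diff psi_vd F_vector_deriv) auto
    qed (use KF_pos MF_nonneg in auto)
    then show ?thesis by (simp add: mult_ac)
  qed
  define r where "r = X_nrm (orbit c 0 - P)"
  \<comment> \<open>On the first edge \<open>orbit c 0\<close> lies strictly above the kink by
    \<open>F_final_pos\<close>, so already that component has positive distance.\<close>
  have "0 < r"
  proof -
    have "lift c (\<lambda>s. F 1 0 0 s - psi s0 s) \<in> L2Y"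
    proof (rule lift_L2Y[OF c, where K = "KF * MF"])
      show "continuous_on {0<..} (\<lambda>s. F 1 0 0 s - psi s0 s)"
        using continuous_on_subset[OF cont_psi] by (intro continuous_intros F_cont_pos) auto
      show "norm (F 1 0 0 s - psi s0 s) \<le> KF * MF * exp (- s)" if "s > 0" for s
        using F_tail(2)[of s 1 0 0] that by (simp add: D_def \<theta>_def coeff_0)
    qed
    then have l: "0 < L2_nrm (lift c (\<lambda>s. F 1 0 0 s - psi s0 s) 1)"
    proof (intro L2_nrm_pos)
      fix x :: real assume "x > 0"
      then have "x / c 1 \<ge> 0" using c by (simp add: less_imp_le)
      then show "lift c (\<lambda>s. F 1 0 0 s - psi s0 s) 1 x \<noteq> 0"
        using F_final_pos[of "x / c 1"] by (simp add: lift_def)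
    qed (auto simp: L2Y_def)
    have e: "orbit c 0 - P = (lift c (\<lambda>s. F 1 0 0 s - psi s0 s), lift c (\<lambda>s. F 2 0 0 s - 0))"
      unfolding P orbit_def minus_prod_def fst_conv snd_conv lift_diff ..
    have "0 < (\<Sum>j\<in>UNIV. (L2_nrm (lift c (\<lambda>s. F 1 0 0 s - psi s0 s) j))\<^sup>2
        + (L2_nrm (dx (lift c (\<lambda>s. F 1 0 0 s - psi s0 s) j)))\<^sup>2 + (L2_nrm (lift c (\<lambda>s. F 2 0 0 s - 0) j))\<^sup>2)"
      by (rule sum_pos2[where i = 1]) (use l in \<open>auto intro!: add_pos_nonneg\<close>)
    then show ?thesis
      unfolding r_def e X_nrm_def prod.case by simp
  qed
  show ?thesis
    unfolding nonlinearly_unstable_def P_def[symmetric]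
  proof (intro exI[of _ "r / 2"] conjI allI impI)
    show "r / 2 > 0" using \<open>0 < r\<close> by simp
    fix delta :: real assume delta: "delta > 0"
    define A where "A = KF * MF * X_exp c"
    have "((\<lambda>T. exp (- \<mu> * T) * A) \<longlongrightarrow> 0 * A) at_top"
      by (intro tendsto_intros filterlim_compose[OF exp_at_bot]
          filterlim_tendsto_neg_mult_at_bot[OF tendsto_const] filterlim_ident) (use mu_pos in auto)
    then have "\<forall>\<^sub>F T in at_top. exp (- \<mu> * T) * A < delta"
      using delta by (intro order_tendstoD) auto
    then obtain T where T: "exp (- \<mu> * T) * A < delta" "T \<ge> 0"
      using eventually_conj[OF _ eventually_ge_at_top[of 0]] eventually_happens'[OF trivial_limit_at_top_linorder] by blast
    have "X_nrm (P - orbit c (- T)) < delta"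
      using close[of "- T"] T by (simp add: A_def)
    moreover have "sG_solution c lam (orbit c (- T)) T (\<lambda>t. orbit c (t - T))"
      by (rule orbit_solution[OF c T(2) lam robin])
    moreover have "X_nrm (orbit c (T - T) - P) > r / 2"
      using \<open>0 < r\<close> by (simp add: r_def)
    ultimately show "\<exists>w0\<in>X. X_nrm (P - w0) < delta \<and>
        (\<exists>t0\<ge>0. \<exists>w. sG_solution c lam w0 t0 w \<and> X_nrm (w t0 - P) > r / 2)"
      using X[of "- T"] T(2) by (intro bexI[of _ "orbit c (- T)"] conjI exI[of _ T] exI[of _ "\<lambda>t. orbit c (t - T)"]) auto
  qed
qed

end

text \<open>Both Robin conditions have the same parameter \<open>lam / C\<close>: the kink satisfies
  it by the choice of \<open>y\<close>, the mode \<open>g\<close> by the choice of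
  \<open>\<kappa>\<close>.\<close>

lemma Pi_kink_unstable:
  fixes c :: "3 \<Rightarrow> real" and lam :: real
  assumes c: "\<forall>j. 0 < c j" and lam: "lam < - (\<Sum>j\<in>UNIV. c j)"
  shows "linearly_unstable c lam (Pi_kink c lam) \<and> nonlinearly_unstable c lam (Pi_kink c lam)"
proof -
  define C where "C = (\<Sum>j\<in>UNIV. c j)"
  have C: "C > 0" unfolding C_def using c by (intro sum_pos) auto
  have lamC: "lam < - C" using lam by (simp add: C_def)
  define y where "y = y_kink c lam"
  have y: "0 < y" "(1 + y\<^sup>2) / y * arctan y * C = - lam"
    using theI'[OF kink_parameter_ex1[OF C lamC]] by (auto simp: y_def y_kink_def C_def)
  obtain \<kappa> where k: "\<kappa> > 1" "jost (ln y) \<kappa> 0 = lam / C * jost1 (ln y) \<kappa> 0"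
    using robin_eigenvalue[OF y C lamC] by blast
  interpret kink_mode "ln y" \<kappa>
    by unfold_locales (rule k)
  have Pi: "Pi_kink c lam = (lift c (psi (ln y)), 0)"
    by (simp add: Pi_kink_def phi_kink_lift[OF c] y_def)
  have "linearly_unstable c lam (Pi_kink c lam)"
    unfolding Pi using k(2) C by (intro g_linearly_unstable[OF c]) (auto simp: C_def)
  moreover have "nonlinearly_unstable c lam (Pi_kink c lam)"
    unfolding Pi by (rule orbit_nonlinearly_unstable[OF c _ kink_robin[OF y C] k(2)])
      (use C in \<open>simp add: C_def\<close>)
  ultimately show ?thesis ..
qed

text \<open>The threshold is the value of \<open>lam\<close> at \<open>y = 1\<close>, where the
  shifts \<open>b_kink\<close> vanish; they are negative in the first case and nonnegative in the
  second. Both cases are instances of \<open>Pi_kink_unstable\<close>.\<close>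

theorem theorem1p1:
  fixes c :: "3 \<Rightarrow> real" and lam :: real
  assumes c_pos: "\<forall>j. 0 < c j"
    and lam_less: "lam < - (\<Sum>j\<in>UNIV. c j)"
  shows "(- (pi / 2) * (\<Sum>j\<in>UNIV. c j) < lam \<longrightarrow>
            linearly_unstable c lam (Pi_kink c lam) \<and>
            nonlinearly_unstable c lam (Pi_kink c lam)) \<and>
         (lam \<le> - (pi / 2) * (\<Sum>j\<in>UNIV. c j) \<and> c 1 = c 2 \<and> c 2 = c 3 \<longrightarrow>
            linearly_unstable c lam (Pi_kink c lam) \<and>
            nonlinearly_unstable c lam (Pi_kink c lam))"
  using Pi_kink_unstable[OF c_pos lam_less] by blast

end
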